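(* Let $K$ be an infinite field and let $I$ be a monomial ideal in $R=K[x_1,\dots,x_n]$. Let the Newton polytope $\operatorname{np}(I)\subseteq\mathbb{R}^n$ have a minimal set of hyperplanes $$\mathbf{w}_1\cdot\mathbf{u}=b_1,\quad \mathbf{w}_2\cdot\mathbf{u}=b_2,\quad\dots,\quad \mathbf{w}_s\cdot\mathbf{u}=b_s$$ and facet-defining halfspaces $$\mathbf{h}_1\cdot\mathbf{u}\leq c_1,\quad \mathbf{h}_2\cdot\mathbf{u}\leq c_2,\quad\dots,\quad \mathbf{h}_t\cdot\mathbf{u}\leq c_t .$$ Suppose that there exist $\alpha_1,\dots,\alpha_s\in\mathbb{R}$ and $\beta_1,\dots,\beta_t\in\mathbb{R}_{\geq 0}$ such that $$\mathbf{W}:=\sum_{i=1}^s\alpha_i\mathbf{w}_i+\sum_{j=1}^t\beta_j\mathbf{h}_j$$ has all negative entries. Let $k$ be the minimal number of non-zero $\beta_j$ required to achieve $\mathbf{W}$ with all negative entries (the minimum being over all such choices of $\alpha_i\in\mathbb{R}$ and $\beta_j\in\mathbb{R}_{\ge 0}$). Then $$\ell(I)\leq n+1-(s+k).$$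
   Context: The Newton polytope of a monomial ideal $I$ is $\operatorname{np}(I)=\operatorname{conv}\{\mathbf b\in\mathbb{Z}_{\ge0}^n : \mathbf x^{\mathbf b}\in G(I)\}$, where $G(I)$ is the minimal set of monomial generators of $I$ and $\mathbf x^{\mathbf b}=x_1^{b_1}\cdots x_n^{b_n}$. The analytic spread of $I$ is $\ell(I)=\dim\left(R[It]\otimes_R R/\mathfrak m\right)$ (Krull dimension), where $R[It]$ is the Rees algebra and $\mathfrak m=(x_1,\dots,x_n)$. Hyperplane/halfspace description of a polytope $E\subseteq\mathbb{R}^n$: a minimal set of hyperplanes of $E$ is a set of hyperplanes $\mathbf w_i\cdot\mathbf u=b_i$ with the $\mathbf w_i$ linearly independent whose common intersection is the affine hull of $E$; the facet-defining halfspaces $\mathbf h_j\cdot\mathbf u\le c_j$ contain $E$, each supporting hyperplane $\mathbf h_j\cdot\mathbf u=c_j$ meets $E$ in a facet of $E$, and $E$ is the intersection of all the hyperplanes and halfspaces listed. Either list may be empty. *)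

theory Defs
  imports
    "HOL-Analysis.Polytope"
    "HOL-Library.Extended_Nat"
    "HOL-Library.Poly_Mapping"
    "HOL-Computational_Algebra.Polynomial"
    "HOL-Algebra.QuotRing"
    "HOL-Algebra.Ideal_Product"
    "HOL-Algebra.Subrings"
    "HOL-Decision_Procs.Algebra_Aux"
begin

section \<open>Krull dimension\<close>

text \<open>The supremum of the lengths of chains of prime ideals. The zero ring, which has no prime
  ideals, gets dimension 0 here; the rings to which the notion is applied below are nonzero.\<close>

definition krull_dim :: "('a, 'm) ring_scheme \<Rightarrow> enat" where
  "krull_dim R =
     Sup {enat m | m. \<exists>P. (\<forall>i\<le>m. primeideal (P i) R) \<and> (\<forall>i<m. P i \<subset> P (Suc i))}"


section \<open>Tensor product of commutative algebras\<close>

text \<open>The monoid ring over the integers of the multiplicative monoid of pairs. Its additive group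
  is the free abelian group on \<open>carrier A \<times> carrier B\<close>, and the product of the basis elements
  \<open>(a, b)\<close> and \<open>(c, d)\<close> is \<open>(a c, b d)\<close>.\<close>

definition pair_mult ::
  "('a, 'm) ring_scheme \<Rightarrow> ('b, 'k) ring_scheme \<Rightarrow>
   ('a \<times> 'b \<Rightarrow>\<^sub>0 int) \<Rightarrow> ('a \<times> 'b \<Rightarrow>\<^sub>0 int) \<Rightarrow> ('a \<times> 'b \<Rightarrow>\<^sub>0 int)" where
  "pair_mult A B f g =
     frag_extend (\<lambda>(a, b). frag_extend (\<lambda>(c, d). frag_of (a \<otimes>\<^bsub>A\<^esub> c, b \<otimes>\<^bsub>B\<^esub> d)) g) f"

definition pair_ring ::
  "('a, 'm) ring_scheme \<Rightarrow> ('b, 'k) ring_scheme \<Rightarrow> ('a \<times> 'b \<Rightarrow>\<^sub>0 int) ring" where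
  "pair_ring A B =
     \<lparr>carrier = {f. Poly_Mapping.keys f \<subseteq> carrier A \<times> carrier B},
      mult = pair_mult A B,
      one = frag_of (\<one>\<^bsub>A\<^esub>, \<one>\<^bsub>B\<^esub>),
      zero = 0,
      add = (+)\<rparr>"

text \<open>The homomorphisms \<open>\<phi>\<close> and \<open>\<psi>\<close> from \<open>R\<close> to \<open>A\<close> and \<open>B\<close> are the algebra structures. The ideal
  generated by the relations equals the additive subgroup they generate, because a basis element
  times a relation is again a relation.\<close>

definition tensor_relations ::
  "('r, 'l) ring_scheme \<Rightarrow> ('a, 'm) ring_scheme \<Rightarrow> ('r \<Rightarrow> 'a) \<Rightarrow>
   ('b, 'k) ring_scheme \<Rightarrow> ('r \<Rightarrow> 'b) \<Rightarrow> ('a \<times> 'b \<Rightarrow>\<^sub>0 int) set" where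
  "tensor_relations R A \<phi> B \<psi> =
     {frag_of (a \<oplus>\<^bsub>A\<^esub> a', b) - frag_of (a, b) - frag_of (a', b) | a a' b.
        a \<in> carrier A \<and> a' \<in> carrier A \<and> b \<in> carrier B} \<union>
     {frag_of (a, b \<oplus>\<^bsub>B\<^esub> b') - frag_of (a, b) - frag_of (a, b') | a b b'.
        a \<in> carrier A \<and> b \<in> carrier B \<and> b' \<in> carrier B} \<union>
     {frag_of (\<phi> r \<otimes>\<^bsub>A\<^esub> a, b) - frag_of (a, \<psi> r \<otimes>\<^bsub>B\<^esub> b) | r a b.
        r \<in> carrier R \<and> a \<in> carrier A \<and> b \<in> carrier B}"

definition tensor_product ::
  "('r, 'l) ring_scheme \<Rightarrow> ('a, 'm) ring_scheme \<Rightarrow> ('r \<Rightarrow> 'a) \<Rightarrow>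
   ('b, 'k) ring_scheme \<Rightarrow> ('r \<Rightarrow> 'b) \<Rightarrow> ('a \<times> 'b \<Rightarrow>\<^sub>0 int) set ring" where
  "tensor_product R A \<phi> B \<psi> =
     pair_ring A B Quot Idl\<^bsub>pair_ring A B\<^esub> (tensor_relations R A \<phi> B \<psi>)"

lemma pair_mult_of:
  "pair_mult A B (frag_of (a, b)) (frag_of (c, d)) = frag_of (a \<otimes>\<^bsub>A\<^esub> c, b \<otimes>\<^bsub>B\<^esub> d)"
  by (simp add: pair_mult_def)

lemma pair_mult_minus_left: "pair_mult A B (f - g) h = pair_mult A B f h - pair_mult A B g h"
  by (simp add: pair_mult_def frag_extend_diff)

lemma frag_cmul_diff_right: "frag_cmul z (x - y) = frag_cmul z x - frag_cmul z y"
  by (rule poly_mapping_eqI) (simp add: lookup_minus right_diff_distrib)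

lemma pair_mult_minus_right: "pair_mult A B f (g - h) = pair_mult A B f g - pair_mult A B f h"
proof -
  have "pair_mult A B f (g - h) = frag_extend (\<lambda>x.
      (case x of (a, b) \<Rightarrow> frag_extend (\<lambda>(c, d). frag_of (a \<otimes>\<^bsub>A\<^esub> c, b \<otimes>\<^bsub>B\<^esub> d)) g) -
      (case x of (a, b) \<Rightarrow> frag_extend (\<lambda>(c, d). frag_of (a \<otimes>\<^bsub>A\<^esub> c, b \<otimes>\<^bsub>B\<^esub> d)) h)) f"
    unfolding pair_mult_def
    by (rule frag_extend_eq) (simp add: frag_extend_diff split_beta)
  also have "\<dots> = pair_mult A B f g - pair_mult A B f h"
    unfolding pair_mult_def frag_extend_def
    by (simp add: frag_cmul_diff_right split_beta sum_subtractf)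
  finally show ?thesis .
qed

lemma pair_mult_zero [simp]: "pair_mult A B 0 f = 0" "pair_mult A B f 0 = 0"
  using pair_mult_minus_left[of A B f f f] pair_mult_minus_right[of A B f f f]
  by (simp_all add: pair_mult_def)

lemma pair_mult_add_left: "pair_mult A B (f + g) h = pair_mult A B f h + pair_mult A B g h"
  by (simp add: pair_mult_def frag_extend_add)

lemma pair_mult_add_right: "pair_mult A B f (g + h) = pair_mult A B f g + pair_mult A B f h"
  using pair_mult_minus_right[of A B f "g + h" h] by (simp add: algebra_simps)

lemma cring_pair_ring:
  assumes "cring A" and "cring B"
  shows "cring (pair_ring A B)"
proof -
  interpret A: cring A by fact
  interpret B: cring B by fact
  let ?C = "carrier A \<times> carrier B"
  note keysD = pair_mult_minus_left pair_mult_minus_right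
  have closed: "Poly_Mapping.keys (pair_mult A B f g) \<subseteq> ?C"
    if "Poly_Mapping.keys f \<subseteq> ?C" "Poly_Mapping.keys g \<subseteq> ?C" for f g
    unfolding pair_mult_def
    using that
    by (fastforce dest!: subsetD[OF keys_frag_extend] simp: split_beta)
  have assoc: "pair_mult A B (pair_mult A B f g) h = pair_mult A B f (pair_mult A B g h)"
    if "Poly_Mapping.keys f \<subseteq> ?C" "Poly_Mapping.keys g \<subseteq> ?C" "Poly_Mapping.keys h \<subseteq> ?C"
    for f g h
    using that(1)
  proof (induction f rule: frag_induction)
    case (one x)
    show ?case
      using that(2)
    proof (induction g rule: frag_induction)
      case (one y)
      show ?case
        using that(3)
      proof (induction h rule: frag_induction)
        case (one z)
        with \<open>x \<in> ?C\<close> \<open>y \<in> ?C\<close> show ?case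
          by (cases x, cases y, cases z) (simp add: pair_mult_of A.m_assoc B.m_assoc)
      qed (simp_all add: keysD)
    qed (simp_all add: keysD)
  qed (simp_all add: keysD)
  have comm: "pair_mult A B f g = pair_mult A B g f"
    if "Poly_Mapping.keys f \<subseteq> ?C" "Poly_Mapping.keys g \<subseteq> ?C" for f g
    using that(1)
  proof (induction f rule: frag_induction)
    case (one x)
    show ?case
      using that(2)
    proof (induction g rule: frag_induction)
      case (one y)
      with \<open>x \<in> ?C\<close> show ?case
        by (cases x, cases y) (simp add: pair_mult_of A.m_comm B.m_comm)
    qed (simp_all add: keysD)
  qed (simp_all add: keysD)
  have one: "pair_mult A B (frag_of (\<one>\<^bsub>A\<^esub>, \<one>\<^bsub>B\<^esub>)) f = f" if "Poly_Mapping.keys f \<subseteq> ?C" for f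
    using that
  proof (induction f rule: frag_induction)
    case (one x)
    then show ?case by (cases x) (simp add: pair_mult_of)
  qed (simp_all add: keysD)
  have one': "pair_mult A B f (frag_of (\<one>\<^bsub>A\<^esub>, \<one>\<^bsub>B\<^esub>)) = f" if "Poly_Mapping.keys f \<subseteq> ?C" for f
    using comm[of f "frag_of (\<one>\<^bsub>A\<^esub>, \<one>\<^bsub>B\<^esub>)"] one[OF that] that by simp
  show ?thesis
  proof (rule cringI)
    show "abelian_group (pair_ring A B)"
    proof (rule abelian_groupI)
      fix f assume "f \<in> carrier (pair_ring A B)"
      then show "\<exists>g\<in>carrier (pair_ring A B). g \<oplus>\<^bsub>pair_ring A B\<^esub> f = \<zero>\<^bsub>pair_ring A B\<^esub>"
        by (intro bexI[of _ "- f"]) (simp_all add: pair_ring_def)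
    qed (auto simp: pair_ring_def algebra_simps dest: subsetD[OF Poly_Mapping.keys_add])
    show "Group.comm_monoid (pair_ring A B)"
    proof (rule comm_monoidI)
      fix f g h
      assume "f \<in> carrier (pair_ring A B)" "g \<in> carrier (pair_ring A B)"
        "h \<in> carrier (pair_ring A B)"
      then show "f \<otimes>\<^bsub>pair_ring A B\<^esub> g \<otimes>\<^bsub>pair_ring A B\<^esub> h =
          f \<otimes>\<^bsub>pair_ring A B\<^esub> (g \<otimes>\<^bsub>pair_ring A B\<^esub> h)"
        by (simp add: pair_ring_def assoc)
    qed (simp_all add: pair_ring_def closed comm one one')
  qed (simp add: pair_ring_def pair_mult_add_left)
qed

lemma cring_tensor_product:
  assumes "cring R" "cring A" "cring B" "\<phi> \<in> ring_hom R A" "\<psi> \<in> ring_hom R B"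
  shows "cring (tensor_product R A \<phi> B \<psi>)"
proof -
  interpret A: cring A by fact
  interpret B: cring B by fact
  interpret P: cring "pair_ring A B" using assms by (intro cring_pair_ring)
  have *: "f - g \<in> carrier (pair_ring A B)"
    if "f \<in> carrier (pair_ring A B)" "g \<in> carrier (pair_ring A B)" for f g
    using that keys_diff[of f g] by (auto simp: pair_ring_def)
  have "frag_of (a, b) \<in> carrier (pair_ring A B)" if "a \<in> carrier A" "b \<in> carrier B" for a b
    using that by (simp add: pair_ring_def)
  then have "tensor_relations R A \<phi> B \<psi> \<subseteq> carrier (pair_ring A B)"
    unfolding tensor_relations_def
    using assms(4,5) by (auto intro!: * simp: ring_hom_closed)
  then show ?thesis
    unfolding tensor_product_def
    by (intro ideal.quotient_is_cring P.genideal_ideal P.cring_axioms)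
qed


section \<open>Polynomial rings and monomial ideals\<close>

text \<open>Polynomials over \<open>'k\<close> in variables indexed by \<open>'n\<close>: finitely supported coefficient functions
  on exponent vectors. The number of variables is \<open>CARD('n)\<close>.\<close>

type_synonym ('n, 'k) mpoly = "('n \<Rightarrow>\<^sub>0 nat) \<Rightarrow>\<^sub>0 'k"

abbreviation poly_ring :: "('n, 'k::field) mpoly ring" where
  "poly_ring \<equiv> cring_class_ops"

definition monomial :: "('n \<Rightarrow>\<^sub>0 nat) \<Rightarrow> ('n, 'k::field) mpoly" where
  "monomial b = Poly_Mapping.single b 1"

definition monomial_generators :: "('n, 'k::field) mpoly set \<Rightarrow> ('n, 'k) mpoly set \<Rightarrow> bool" where
  "monomial_generators I G \<longleftrightarrow> G \<subseteq> range monomial \<and> Idl\<^bsub>poly_ring\<^esub> G = I"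

definition monomial_ideal :: "('n, 'k::field) mpoly set \<Rightarrow> bool" where
  "monomial_ideal I \<longleftrightarrow> (\<exists>G. monomial_generators I G)"

definition min_monomial_generators :: "('n, 'k::field) mpoly set \<Rightarrow> ('n, 'k) mpoly set" where
  "min_monomial_generators I =
     (THE G. monomial_generators I G \<and> (\<forall>H. H \<subset> G \<longrightarrow> \<not> monomial_generators I H))"

lemma monomial_mult: "monomial b * monomial c = monomial (b + c)"
  by (simp add: monomial_def Poly_Mapping.mult_single)

lemma inj_monomial: "monomial b = (monomial c :: ('n, 'k::field) mpoly) \<longleftrightarrow> b = c"
proof
  assume "monomial b = (monomial c :: ('n, 'k) mpoly)"
  then have "Poly_Mapping.keys (monomial b :: ('n, 'k) mpoly) =
      Poly_Mapping.keys (monomial c :: ('n, 'k) mpoly)"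
    by simp
  then show "b = c" by (simp add: monomial_def)
qed simp

lemmas genideal_ideal_class = ring.genideal_ideal[OF cring.axioms(1)[OF cring_class]]
lemmas genideal_self_class = ring.genideal_self[OF cring.axioms(1)[OF cring_class]]
lemmas genideal_minimal_class = ring.genideal_minimal[OF cring.axioms(1)[OF cring_class]]

lemma monomial_in_Idl_iff:
  fixes G :: "('n, 'k::field) mpoly set"
  assumes G: "G \<subseteq> range monomial"
  shows "monomial b \<in> Idl\<^bsub>poly_ring\<^esub> G \<longleftrightarrow> (\<exists>c d. monomial c \<in> G \<and> b = c + d)"
proof
  define J :: "('n, 'k) mpoly set" where
    "J = {p. \<forall>b\<in>Poly_Mapping.keys p. \<exists>c d. monomial c \<in> G \<and> b = c + d}"
  have mult: "q * p \<in> J" "p * q \<in> J" if p: "p \<in> J" for p q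
  proof -
    {
      fix b assume "b \<in> Poly_Mapping.keys (q * p)"
      then obtain e f where "f \<in> Poly_Mapping.keys p" "b = e + f"
        using keys_mult[of q p] by blast
      moreover from this p obtain c d where "monomial c \<in> G" "f = c + d"
        by (auto simp: J_def)
      ultimately have "\<exists>c d. monomial c \<in> G \<and> b = c + d"
        by (intro exI[of _ c] exI[of _ "e + d"]) (simp add: algebra_simps)
    }
    then show "q * p \<in> J" by (simp add: J_def)
    then show "p * q \<in> J" by (simp add: mult.commute)
  qed
  have "ideal J poly_ring"
  proof (rule idealI)
    show "subgroup J (add_monoid poly_ring)"
    proof (rule group.subgroupI[OF abelian_group.a_group[OF cring_class.abelian_group_axioms]])
      have "0 \<in> J" by (simp add: J_def)
      then show "J \<noteq> {}" by blast
    next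
      fix p assume "p \<in> J"
      then show "inv\<^bsub>add_monoid poly_ring\<^esub> p \<in> J"
        by (fold a_inv_def) (simp add: J_def uminus_class)
    next
      fix p q assume "p \<in> J" "q \<in> J"
      then show "p \<otimes>\<^bsub>add_monoid poly_ring\<^esub> q \<in> J"
        using keys_add[of p q] by (auto simp: J_def cring_class_ops_def)
    qed (simp add: cring_class_ops_def)
  qed (simp_all add: cring_class.ring_axioms mult times_class)
  moreover have "G \<subseteq> J"
  proof
    fix p assume "p \<in> G"
    moreover from this G obtain c where "p = monomial c" by blast
    moreover have "c = c + 0" by simp
    ultimately have "\<exists>c' d. monomial c' \<in> G \<and> c = c' + d" by blast
    with \<open>p = monomial c\<close> show "p \<in> J"
      by (simp add: J_def monomial_def)
  qed
  ultimately have "Idl\<^bsub>poly_ring\<^esub> G \<subseteq> J"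
    by (rule genideal_minimal_class)
  moreover assume "monomial b \<in> Idl\<^bsub>poly_ring\<^esub> G"
  ultimately show "\<exists>c d. monomial c \<in> G \<and> b = c + d"
    by (auto simp: J_def monomial_def)
next
  have "ideal (Idl\<^bsub>poly_ring\<^esub> G) poly_ring"
    by (intro genideal_ideal_class) (simp add: cring_class_ops_def)
  moreover have "G \<subseteq> Idl\<^bsub>poly_ring\<^esub> G"
    by (intro genideal_self_class) (simp add: cring_class_ops_def)
  moreover assume "\<exists>c d. monomial c \<in> G \<and> b = c + d"
  then obtain c d where "monomial c \<in> G" "b = c + d" by blast
  ultimately show "monomial b \<in> Idl\<^bsub>poly_ring\<^esub> G"
    using ideal.I_r_closed[of "Idl\<^bsub>poly_ring\<^esub> G" poly_ring "monomial c" "monomial d"]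
    by (auto simp: monomial_mult carrier_class times_class)
qed

text \<open>The minimal set of monomial generators is well defined.\<close>

lemma ex1_min_monomial_generators:
  fixes I :: "('n::finite, 'k::field) mpoly set"
  assumes "monomial_ideal I"
  shows "\<exists>!G. monomial_generators I G \<and> (\<forall>H. H \<subset> G \<longrightarrow> \<not> monomial_generators I H)"
proof -
  obtain S where S: "monomial_generators I S"
    using assms by (auto simp: monomial_ideal_def)
  define G :: "('n, 'k) mpoly set" where
    "G = {monomial b | b. monomial b \<in> I \<and> (\<forall>c d. monomial c \<in> I \<and> b = c + d \<longrightarrow> d = 0)}"
  have below: "\<exists>c d. monomial c \<in> G \<and> b = c + d" if "monomial b \<in> I" for b
    using that
  proof (induction "\<Sum>i\<in>UNIV. Poly_Mapping.lookup b i" arbitrary: b rule: less_induct)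
    case less
    show ?case
    proof (cases "monomial b \<in> G")
      case True
      then show ?thesis by (intro exI[of _ b] exI[of _ 0]) simp
    next
      case False
      with less.prems obtain c d where cd: "monomial c \<in> I" "b = c + d" "d \<noteq> 0"
        by (auto simp: G_def)
      obtain i where "Poly_Mapping.lookup d i \<noteq> 0"
        using \<open>d \<noteq> 0\<close> by (metis lookup_zero poly_mapping_eqI)
      then have "(\<Sum>i\<in>UNIV. Poly_Mapping.lookup c i) < (\<Sum>i\<in>UNIV. Poly_Mapping.lookup b i)"
        using cd(2) by (intro sum_strict_mono_ex1) (auto simp: lookup_add intro!: exI[of _ i])
      from less.hyps[OF this cd(1)] obtain e f where "monomial e \<in> G" "c = e + f" by blast
      with cd(2) show ?thesis
        by (intro exI[of _ e] exI[of _ "f + d"]) (simp add: algebra_simps)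
    qed
  qed
  have sub: "G \<subseteq> H" if "monomial_generators I H" for H
  proof
    fix p assume "p \<in> G"
    then obtain b where b: "p = monomial b" "monomial b \<in> I"
      "\<And>c d. monomial c \<in> I \<Longrightarrow> b = c + d \<Longrightarrow> d = 0"
      by (auto simp: G_def)
    have H: "H \<subseteq> range monomial" "Idl\<^bsub>poly_ring\<^esub> H = I"
      using that by (auto simp: monomial_generators_def)
    have "H \<subseteq> I"
      using H(2) genideal_self_class[of H] by (simp add: cring_class_ops_def)
    from b(2) H obtain c d where "monomial c \<in> H" "b = c + d"
      using monomial_in_Idl_iff[of H b] by auto
    moreover from this have "d = 0" using b(3) \<open>H \<subseteq> I\<close> by blast
    ultimately show "p \<in> H" using b(1) by simp
  qed
  have I: "ideal I poly_ring"
    using S genideal_ideal_class[of S]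
    by (auto simp: monomial_generators_def cring_class_ops_def)
  have "Idl\<^bsub>poly_ring\<^esub> G \<subseteq> I"
    using I by (intro genideal_minimal_class) (auto simp: G_def)
  moreover have "I \<subseteq> Idl\<^bsub>poly_ring\<^esub> G"
  proof -
    have "S \<subseteq> Idl\<^bsub>poly_ring\<^esub> G"
    proof
      fix p assume "p \<in> S"
      moreover have "S \<subseteq> I"
        using S genideal_self_class[of S]
        by (auto simp: monomial_generators_def cring_class_ops_def)
      moreover obtain b where "p = monomial b"
        using S \<open>p \<in> S\<close> by (auto simp: monomial_generators_def)
      moreover have "G \<subseteq> range monomial" by (auto simp: G_def)
      ultimately show "p \<in> Idl\<^bsub>poly_ring\<^esub> G"
        using below[of b] monomial_in_Idl_iff[of G b] by auto
    qed
    then have "Idl\<^bsub>poly_ring\<^esub> S \<subseteq> Idl\<^bsub>poly_ring\<^esub> G"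
      by (intro genideal_minimal_class genideal_ideal_class) (auto simp: carrier_class)
    then show ?thesis using S by (simp add: monomial_generators_def)
  qed
  ultimately have G: "monomial_generators I G"
    by (auto simp: monomial_generators_def G_def)
  show ?thesis
  proof (rule ex1I[of _ G])
    show "monomial_generators I G \<and> (\<forall>H. H \<subset> G \<longrightarrow> \<not> monomial_generators I H)"
      using G sub by blast
  next
    fix H assume "monomial_generators I H \<and> (\<forall>H'. H' \<subset> H \<longrightarrow> \<not> monomial_generators I H')"
    then show "H = G" using G sub[of H] by blast
  qed
qed


section \<open>Newton polytope\<close>

definition newton_polytope :: "('n::finite, 'k::field) mpoly set \<Rightarrow> (real ^ 'n) set" where
  "newton_polytope I =
     convex hull {\<chi> i. real (Poly_Mapping.lookup b i) | b. monomial b \<in> min_monomial_generators I}"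


section \<open>Analytic spread\<close>

text \<open>The Rees algebra as the subring of \<open>R[t]\<close> whose elements are the polynomials
  with \<open>m\<close>-th coefficient in the \<open>m\<close>-th power of \<open>I\<close>.\<close>

definition rees_algebra :: "('n, 'k::field) mpoly set \<Rightarrow> ('n, 'k) mpoly poly ring" where
  "rees_algebra I =
     cring_class_ops
       \<lparr>carrier := {p. \<forall>m. Polynomial.coeff p m \<in> I [^]\<^bsub>ideals_set poly_ring\<^esub> (m::nat)}\<rparr>"

definition irrelevant_ideal :: "('n, 'k::field) mpoly set" where
  "irrelevant_ideal = Idl\<^bsub>poly_ring\<^esub> (range (\<lambda>i. monomial (Poly_Mapping.single i 1)))"

definition fiber_ring ::
  "('n, 'k::field) mpoly set \<Rightarrow> (('n, 'k) mpoly poly \<times> ('n, 'k) mpoly set \<Rightarrow>\<^sub>0 int) set ring" where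
  "fiber_ring I =
     tensor_product poly_ring
       (rees_algebra I) (\<lambda>r. [:r:])
       (poly_ring Quot irrelevant_ideal) (\<lambda>r. irrelevant_ideal +>\<^bsub>poly_ring\<^esub> r)"

definition analytic_spread :: "('n, 'k::field) mpoly set \<Rightarrow> enat" where
  "analytic_spread I = krull_dim (fiber_ring I)"

lemma ideals_power:
  fixes I :: "('n, 'k::field) mpoly set"
  assumes "ideal I poly_ring"
  shows "ideal (I [^]\<^bsub>ideals_set poly_ring\<^esub> (m::nat)) poly_ring"
    and "p \<in> I [^]\<^bsub>ideals_set poly_ring\<^esub> i \<Longrightarrow> q \<in> I [^]\<^bsub>ideals_set poly_ring\<^esub> j \<Longrightarrow>
      p * q \<in> I [^]\<^bsub>ideals_set poly_ring\<^esub> (i + j :: nat)"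
proof -
  interpret M: Group.comm_monoid "ideals_set (poly_ring :: ('n, 'k) mpoly ring)"
    by (rule cring.ideals_set_is_comm_monoid[OF cring_class])
  have I: "I \<in> carrier (ideals_set poly_ring)" using assms by (simp add: ideals_set_def)
  then show "ideal (I [^]\<^bsub>ideals_set poly_ring\<^esub> m) poly_ring" for m :: nat
    using M.nat_pow_closed[OF I, of m] by (simp add: ideals_set_def)
  assume "p \<in> I [^]\<^bsub>ideals_set poly_ring\<^esub> i" "q \<in> I [^]\<^bsub>ideals_set poly_ring\<^esub> j"
  then have "p \<otimes>\<^bsub>poly_ring\<^esub> q \<in> ideal_prod poly_ring (I [^]\<^bsub>ideals_set poly_ring\<^esub> i) (I [^]\<^bsub>ideals_set poly_ring\<^esub> j)"
    by (rule ideal_prod.prod)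
  then show "p * q \<in> I [^]\<^bsub>ideals_set poly_ring\<^esub> (i + j)"
    using M.nat_pow_mult[OF I, of i j] by (simp add: ideals_set_def times_class)
qed

lemma ideal_classD:
  assumes "ideal J (cring_class_ops :: 'a::comm_ring_1 ring)"
  shows "0 \<in> J" "x \<in> J \<Longrightarrow> y \<in> J \<Longrightarrow> x + y \<in> J" "x \<in> J \<Longrightarrow> - x \<in> J"
  using additive_subgroup.zero_closed[OF ideal.axioms(1)[OF assms]]
    additive_subgroup.a_closed[OF ideal.axioms(1)[OF assms], of x y]
    additive_subgroup.a_inv_closed[OF ideal.axioms(1)[OF assms], of x]
  by (simp_all add: class_simps)

lemma ideal_sum_closed:
  assumes "ideal J (cring_class_ops :: 'a::comm_ring_1 ring)" "\<And>i. i \<in> A \<Longrightarrow> f i \<in> J"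
  shows "sum f A \<in> J"
  using assms(2) by (induction A rule: infinite_finite_induct) (auto intro: ideal_classD[OF assms(1)])

lemma cring_rees:
  fixes I :: "('n, 'k::field) mpoly set"
  assumes I: "ideal I poly_ring"
  shows "cring (rees_algebra I)" "(\<lambda>r. [:r:]) \<in> ring_hom poly_ring (rees_algebra I)"
proof -
  let ?P = "\<lambda>m::nat. I [^]\<^bsub>ideals_set poly_ring\<^esub> m"
  let ?A = "{p. \<forall>m. Polynomial.coeff p m \<in> ?P m}"
  note id = ideals_power(1)[OF I] and mu = ideals_power(2)[OF I]
  have 0: "?P 0 = UNIV" by (simp add: ideals_set_def cring_class_ops_def)
  have const: "[:r:] \<in> ?A" for r
  proof -
    have "Polynomial.coeff [:r:] m \<in> ?P m" for m
      using 0 ideal_classD(1)[OF id[of m]] by (cases m) (simp_all del: nat_pow_Suc)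
    then show ?thesis by simp
  qed
  have "subring ?A cring_class_ops"
  proof (rule ring.subringI[OF cring.axioms(1)[OF cring_class]])
    show "\<one>\<^bsub>cring_class_ops\<^esub> \<in> ?A" using const[of 1] by (simp add: one_class flip: one_pCons)
  next
    fix p q assume "p \<in> ?A" "q \<in> ?A"
    then show "p \<oplus>\<^bsub>cring_class_ops\<^esub> q \<in> ?A" by (simp add: plus_class ideal_classD[OF id])
    have "Polynomial.coeff (p * q) m \<in> ?P m" for m
      unfolding coeff_mult
    proof (rule ideal_sum_closed[OF id])
      fix i assume "i \<in> {..m}"
      then have "i + (m - i) = m" by simp
      moreover have "Polynomial.coeff p i \<in> ?P i" "Polynomial.coeff q (m - i) \<in> ?P (m - i)"
        using \<open>p \<in> ?A\<close> \<open>q \<in> ?A\<close> by blast+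
      ultimately show "Polynomial.coeff p i * Polynomial.coeff q (m - i) \<in> ?P m"
        using mu by metis
    qed
    then show "p \<otimes>\<^bsub>cring_class_ops\<^esub> q \<in> ?A" by (simp add: times_class)
  qed (auto simp: class_simps carrier_class ideal_classD[OF id])
  then have "subcring ?A cring_class_ops"
    by (rule cring.subcringI'[OF cring_class])
  then show "cring (rees_algebra I)"
    unfolding rees_algebra_def
    by (subst (asm) ring.subcring_iff[OF cring.axioms(1)[OF cring_class]])
      (simp_all add: subset_iff carrier_class)
  show "(\<lambda>r. [:r:]) \<in> ring_hom poly_ring (rees_algebra I)"
    using const by (intro ring_hom_memI) (auto simp: rees_algebra_def cring_class_ops_def one_pCons)
qed

text \<open>The locale \<open>primeideal\<close> presupposes a commutative ring, so \<open>krull_dim\<close> is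
  meaningful for \<open>fiber_ring I\<close> because of the following fact.\<close>

lemma cring_fiber_ring:
  fixes I :: "('n, 'k::field) mpoly set"
  assumes "ideal I poly_ring"
  shows "cring (fiber_ring I)"
proof -
  have "ideal irrelevant_ideal (poly_ring :: ('n, 'k) mpoly ring)"
    unfolding irrelevant_ideal_def by (intro genideal_ideal_class) (auto simp: carrier_class)
  then show ?thesis
    unfolding fiber_ring_def
    by (intro cring_tensor_product cring_class cring_rees assms
        ideal.quotient_is_cring ideal.rcos_ring_hom)
qed


section \<open>Hyperplane and halfspace descriptions\<close>

definition minimal_hyperplanes ::
  "'a::euclidean_space set \<Rightarrow> nat \<Rightarrow> (nat \<Rightarrow> 'a) \<Rightarrow> (nat \<Rightarrow> real) \<Rightarrow> bool" where
  "minimal_hyperplanes E s w b \<longleftrightarrow>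
     inj_on w {..<s} \<and> independent (w ` {..<s}) \<and>
     (\<Inter>i<s. {u. w i \<bullet> u = b i}) = affine hull E"

definition facet_halfspaces ::
  "'a::euclidean_space set \<Rightarrow> nat \<Rightarrow> (nat \<Rightarrow> 'a) \<Rightarrow> (nat \<Rightarrow> real) \<Rightarrow> bool" where
  "facet_halfspaces E t h c \<longleftrightarrow>
     (\<forall>j<t. E \<subseteq> {u. h j \<bullet> u \<le> c j} \<and> (E \<inter> {u. h j \<bullet> u = c j}) facet_of E)"

definition halfspace_description ::
  "'a::euclidean_space set \<Rightarrow> nat \<Rightarrow> (nat \<Rightarrow> 'a) \<Rightarrow> (nat \<Rightarrow> real) \<Rightarrow>
     nat \<Rightarrow> (nat \<Rightarrow> 'a) \<Rightarrow> (nat \<Rightarrow> real) \<Rightarrow> bool" where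
  "halfspace_description E s w b t h c \<longleftrightarrow>
     minimal_hyperplanes E s w b \<and> facet_halfspaces E t h c \<and>
     E = (\<Inter>i<s. {u. w i \<bullet> u = b i}) \<inter> (\<Inter>j<t. {u. h j \<bullet> u \<le> c j})"

definition negative_combination ::
  "nat \<Rightarrow> (nat \<Rightarrow> real ^ 'n) \<Rightarrow> nat \<Rightarrow> (nat \<Rightarrow> real ^ 'n) \<Rightarrow> (nat \<Rightarrow> real) \<Rightarrow> (nat \<Rightarrow> real) \<Rightarrow> bool" where
  "negative_combination s w t h \<alpha> \<beta> \<longleftrightarrow>
     (\<forall>j<t. \<beta> j \<ge> 0) \<and>
     (\<forall>l. ((\<Sum>i<s. \<alpha> i *\<^sub>R w i) + (\<Sum>j<t. \<beta> j *\<^sub>R h j)) $ l < 0)"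

end

theory Submission
  imports Defs "HOL-Analysis.Kronecker_Approximation_Theorem"
begin

text \<open>A chain of primes of the fiber ring pulls back to a chain \<open>Q\<^sub>0 \<subset> \<dots> \<subset> Q\<^sub>m\<close> in the Rees algebra whose
  members contain \<open>\<mm>\<close>. Let \<open>S\<close> be the set of generators \<open>b\<close> with \<open>x\<^sup>b t \<notin> Q\<^sub>0\<close>. The barycenter of a
  finite subset of \<open>S\<close> dominates no other point of the Newton polytope: by simultaneous Dirichlet
  approximation such a domination would be witnessed by integers, and then a product of elements
  outside \<open>Q\<^sub>0\<close> would lie in \<open>\<mm> R[It] \<subseteq> Q\<^sub>0\<close>. By separation of convex sets, the hyperplanes together with
  the halfspaces active at the barycenter therefore have a negative combination, and a combination of
  minimal support exhibits at least \<open>s + k\<close> independent linear forms that are constant on the chosen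
  generators. So the algebra generated by these modulo \<open>Q\<^sub>0\<close> has polynomial growth of degree at most
  \<open>n + 1 - (s + k)\<close>. On the other hand, elements \<open>y\<^sub>i \<in> Q\<^sub>i\<^sub>+\<^sub>1 - Q\<^sub>i\<close> are algebraically independent modulo
  \<open>Q\<^sub>0\<close>, so \<open>m\<close> is at most the degree of growth.\<close>

section \<open>Negative combinations and lattice points\<close>

text \<open>A theorem of the alternative in the manner of Gordan and Motzkin: either the cone of
  admissible combinations meets the open negative orthant, or a hyperplane separates the two convex
  sets and its normal is the direction \<open>y\<close>. The set \<open>J\<close> selects the
  halfspaces whose coefficients may be non-zero.\<close>

lemma negative_combination_alternative:
  fixes w h :: "nat \<Rightarrow> real ^ 'n::finite"
  obtains (combination) \<alpha> \<beta> where "negative_combination s w t h \<alpha> \<beta>" "\<And>j. j < t \<Longrightarrow> j \<notin> J \<Longrightarrow> \<beta> j = 0"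
  | (direction) y where "y \<noteq> 0" "\<And>l. 0 \<le> y $ l" "\<And>i. i < s \<Longrightarrow> w i \<bullet> y = 0"
      "\<And>j. j < t \<Longrightarrow> j \<in> J \<Longrightarrow> 0 \<le> h j \<bullet> y"
proof -
  define f where "f = (\<lambda>\<alpha> \<beta>. (\<Sum>i<s. \<alpha> i *\<^sub>R w i) + (\<Sum>j<t. \<beta> j *\<^sub>R h j))"
  define good where "good = (\<lambda>\<beta>::nat \<Rightarrow> real. \<forall>j<t. 0 \<le> \<beta> j \<and> (j \<notin> J \<longrightarrow> \<beta> j = 0))"
  define C where "C = {f \<alpha> \<beta> | \<alpha> \<beta>. good \<beta>}"
  define N where "N = {x :: real ^ 'n. \<forall>l. x $ l < 0}"
  have lin: "u *\<^sub>R f \<alpha> \<beta> + v *\<^sub>R f \<alpha>' \<beta>' = f (\<lambda>i. u * \<alpha> i + v * \<alpha>' i) (\<lambda>j. u * \<beta> j + v * \<beta>' j)" for u v \<alpha> \<beta> \<alpha>' \<beta>'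
    by (simp add: f_def scaleR_add_right scaleR_add_left scaleR_sum_right sum.distrib)
  have convC: "convex C"
  proof (rule convexI)
    fix x y and u v :: real
    assume "x \<in> C" "y \<in> C" and uv: "0 \<le> u" "0 \<le> v"
    then obtain \<alpha> \<beta> \<alpha>' \<beta>' where "x = f \<alpha> \<beta>" "good \<beta>" "y = f \<alpha>' \<beta>'" "good \<beta>'"
      by (auto simp: C_def)
    moreover from this uv have "good (\<lambda>j. u * \<beta> j + v * \<beta>' j)" by (simp add: good_def)
    ultimately show "u *\<^sub>R x + v *\<^sub>R y \<in> C" by (auto simp: C_def lin)
  qed
  have convN: "convex N"
  proof (rule convexI)
    fix x y :: "real ^ 'n" and u v :: real
    assume xy: "x \<in> N" "y \<in> N" and uv: "0 \<le> u" "0 \<le> v" "u + v = 1"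
    have "u * x $ l + v * y $ l < 0" for l
    proof (rule convex_bound_lt)
      show "x $ l < 0" "y $ l < 0" using xy by (auto simp: N_def)
    qed (use uv in auto)
    then show "u *\<^sub>R x + v *\<^sub>R y \<in> N" by (simp add: N_def)
  qed
  show thesis
  proof (cases "N \<inter> C = {}")
    case False
    then obtain \<alpha> \<beta> where "f \<alpha> \<beta> \<in> N" "good \<beta>" by (auto simp: C_def)
    then show thesis
      by (intro combination[of \<alpha> \<beta>]) (auto simp: negative_combination_def f_def good_def N_def)
  next
    case True
    have "f (\<lambda>_. 0) (\<lambda>_. 0) \<in> C" by (auto simp: C_def good_def)
    then have zero: "0 \<in> C" by (simp add: f_def)
    have "(\<chi> l. -1) \<in> N" by (simp add: N_def)
    then obtain a d where a: "a \<noteq> 0" "\<forall>x\<in>N. a \<bullet> x \<le> d" "\<forall>x\<in>C. a \<bullet> x \<ge> d"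
      using separating_hyperplane_sets[OF convN convC _ _ True] zero by blast
    have d: "d \<le> 0" using a(3) zero by auto
    have nonneg: "0 \<le> a \<bullet> f \<alpha> \<beta>" if "good \<beta>" for \<alpha> \<beta>
    proof (rule ccontr)
      assume neg: "\<not> 0 \<le> a \<bullet> f \<alpha> \<beta>"
      \<comment> \<open>\<open>C\<close> is a cone, so a negative value of the functional could be
        scaled to \<open>d - 1\<close>, below the separating level \<open>d\<close>.\<close>
      define r where "r = (d - 1) / (a \<bullet> f \<alpha> \<beta>)"
      have "0 \<le> r" using neg d by (simp add: r_def divide_nonpos_neg)
      then have "r *\<^sub>R f \<alpha> \<beta> + 0 *\<^sub>R f \<alpha> \<beta> \<in> C"
        unfolding lin C_def using that
        by (intro CollectI exI[of _ "\<lambda>i. r * \<alpha> i + 0 * \<alpha> i"] exI[of _ "\<lambda>j. r * \<beta> j + 0 * \<beta> j"])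
          (simp add: good_def)
      then have "d \<le> a \<bullet> (r *\<^sub>R f \<alpha> \<beta>)" using a(3) by auto
      also have "\<dots> = d - 1" using neg by (simp add: r_def)
      finally show False by simp
    qed
    show thesis
    proof (rule direction[of a])
      show "a \<noteq> 0" by fact
    next
      fix l
      show "0 \<le> a $ l"
      proof (rule ccontr)
        assume neg: "\<not> 0 \<le> a $ l"
        define S where "S = (\<Sum>i\<in>UNIV. a $ i)"
        \<comment> \<open>The test vector \<open>x\<close> is the negative unit vector at
          \<open>l\<close>, shifted by \<open>- e\<close> in every coordinate to lie in the open
          orthant \<open>N\<close>. The shift lowers the inner product with \<open>a\<close> by at
          most half of \<open>- (a $ l)\<close>, so \<open>a \<bullet> x\<close> stays
          positive.\<close>
        define e where "e = - (a $ l) / (2 * (\<bar>S\<bar> + 1))"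
        have e: "e > 0" unfolding e_def using neg by (intro divide_pos_pos) auto
        define x :: "real ^ 'n" where "x = (\<chi> i. (if i = l then -1 else 0) - e)"
        have "x \<in> N" using e by (simp add: x_def N_def)
        then have "a \<bullet> x \<le> 0" using a(2) d by fastforce
        moreover have "a \<bullet> x = - (a $ l) - e * S"
        proof -
          have "a \<bullet> x = (\<Sum>i\<in>UNIV. (if i = l then - (a $ l) else 0) - e * a $ i)"
            unfolding inner_vec_def by (intro sum.cong) (auto simp: x_def algebra_simps)
          then show ?thesis
            unfolding sum_subtractf S_def sum_distrib_left by simp
        qed
        moreover have "e * S \<le> e * (\<bar>S\<bar> + 1)" using e by (intro mult_left_mono) auto
        moreover have "e * (\<bar>S\<bar> + 1) = - (a $ l) / 2" by (simp add: e_def field_simps)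
        ultimately show False using neg by auto
      qed
    next
      fix i assume i: "i < s"
      have fi: "f (\<lambda>k. if k = i then r else 0) (\<lambda>_. 0) = r *\<^sub>R w i" for r
        using i by (simp add: f_def if_distrib[of "\<lambda>x. x *\<^sub>R _"] cong: if_cong)
      \<comment> \<open>The coefficients \<alpha> have free sign, so \<open>C\<close> contains both
        \<open>w i\<close> and \<open>- w i\<close>, and the inequality becomes an equality.\<close>
      show "w i \<bullet> a = 0"
        using nonneg[of "\<lambda>_. 0" "\<lambda>k. if k = i then 1 else 0"]
          nonneg[of "\<lambda>_. 0" "\<lambda>k. if k = i then -1 else 0"]
        by (simp add: fi good_def inner_commute)
    next
      fix j assume j: "j < t" "j \<in> J"
      have "f (\<lambda>_. 0) (\<lambda>k. if k = j then 1 else 0) = h j"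
        using j by (simp add: f_def if_distrib[of "\<lambda>x. x *\<^sub>R _"] cong: if_cong)
      then show "0 \<le> h j \<bullet> a"
        using nonneg[of "\<lambda>k. if k = j then 1 else 0" "\<lambda>_. 0"] j
        by (auto simp add: good_def inner_commute)
    qed
  qed
qed

text \<open>A Caratheodory argument: in a combination of minimal support inside \<open>J\<close>, a
  normal that depends on the \<open>w i\<close> and the other normals of the support could be traded
  away without changing the vector. The cardinality clause also records that the \<open>h j\<close>
  of the support are distinct and differ from all \<open>w i\<close>.\<close>

lemma independent_negative_support:
  fixes w h :: "nat \<Rightarrow> real ^ 'n::finite"
  assumes inj: "inj_on w {..<s}" and ind: "independent (w ` {..<s})"
    and "negative_combination s w t h \<alpha>0 \<beta>0" "\<And>j. j < t \<Longrightarrow> j \<notin> J \<Longrightarrow> \<beta>0 j = 0"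
  obtains \<alpha> \<beta> where "negative_combination s w t h \<alpha> \<beta>" "{j. j < t \<and> \<beta> j \<noteq> 0} \<subseteq> J"
    "independent (w ` {..<s} \<union> h ` {j. j < t \<and> \<beta> j \<noteq> 0})"
    "card (w ` {..<s} \<union> h ` {j. j < t \<and> \<beta> j \<noteq> 0}) = s + card {j. j < t \<and> \<beta> j \<noteq> 0}"
proof -
  define supp where "supp = (\<lambda>\<beta>::nat \<Rightarrow> real. {j. j < t \<and> \<beta> j \<noteq> 0})"
  define P where "P = (\<lambda>(\<alpha>, \<beta>). negative_combination s w t h \<alpha> \<beta> \<and> supp \<beta> \<subseteq> J)"
  have "P (\<alpha>0, \<beta>0)" using assms(3,4) by (auto simp: P_def supp_def)
  then have "\<exists>x. P x \<and> (\<forall>y. P y \<longrightarrow> card (supp (snd x)) \<le> card (supp (snd y)))"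
    by (rule ex_has_least_nat)
  then obtain \<alpha> \<beta> where nc: "negative_combination s w t h \<alpha> \<beta>" and J: "supp \<beta> \<subseteq> J"
    and min: "\<And>\<alpha>' \<beta>'. negative_combination s w t h \<alpha>' \<beta>' \<Longrightarrow> supp \<beta>' \<subseteq> J \<Longrightarrow> card (supp \<beta>) \<le> card (supp \<beta>')"
    by (auto simp: P_def)
  have fin: "finite (supp \<beta>)" for \<beta> by (simp add: supp_def)
  have notin: "h j \<notin> span (w ` {..<s} \<union> h ` (supp \<beta> - {j}))" if j: "j \<in> supp \<beta>" for j
  proof
    define K where "K = supp \<beta> - {j}"
    assume "h j \<in> span (w ` {..<s} \<union> h ` (supp \<beta> - {j}))"
    then obtain x y where "h j = x + y" "x \<in> span (w ` {..<s})" "y \<in> span (h ` K)"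
      by (auto simp: span_Un K_def)
    moreover from this(2) obtain a where "x = (\<Sum>i<s. a i *\<^sub>R w i)"
      unfolding span_finite[OF finite_imageI[OF finite_lessThan]]
      by (auto simp: sum.reindex[OF inj])
    moreover have "\<exists>g. y = (\<Sum>l\<in>K. g l *\<^sub>R h l)"
    proof -
      have "finite K" by (simp add: K_def fin)
      then show ?thesis using \<open>y \<in> span (h ` K)\<close>
      proof (induction K arbitrary: y)
        case (insert l K)
        then obtain k where "y - k *\<^sub>R h l \<in> span (h ` K)" by (auto simp: span_insert)
        with insert.IH obtain g where g: "y - k *\<^sub>R h l = (\<Sum>l\<in>K. g l *\<^sub>R h l)" by blast
        have "(\<Sum>x\<in>K. (g(l := k)) x *\<^sub>R h x) = (\<Sum>l\<in>K. g l *\<^sub>R h l)"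
          using insert.hyps by (intro sum.cong) auto
        then have "y = (\<Sum>x\<in>insert l K. (g(l := k)) x *\<^sub>R h x)"
          using insert.hyps g by (simp add: algebra_simps)
        then show ?case by blast
      qed simp
    qed
    ultimately obtain a g where ag: "h j = (\<Sum>i<s. a i *\<^sub>R w i) + (\<Sum>l\<in>K. g l *\<^sub>R h l)" by auto
    \<comment> \<open>The coefficients of the linear relation: moving \<beta> along
      \<open>- \<delta>\<close> and \<alpha> along \<open>a\<close> leaves the combination
      fixed.\<close>
    define \<delta> where "\<delta> = (\<lambda>l. if l = j then 1 else if l \<in> K then - g l else 0)"
    have "(\<Sum>l<t. \<delta> l *\<^sub>R h l) = (\<Sum>l\<in>insert j K. \<delta> l *\<^sub>R h l)"
      using j by (intro sum.mono_neutral_right) (auto simp: \<delta>_def K_def supp_def)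
    also have "\<dots> = h j - (\<Sum>l\<in>K. g l *\<^sub>R h l)"
    proof -
      have "(\<Sum>l\<in>K. \<delta> l *\<^sub>R h l) = - (\<Sum>l\<in>K. g l *\<^sub>R h l)"
        unfolding sum_negf[symmetric] by (intro sum.cong) (auto simp: \<delta>_def K_def)
      moreover have "\<delta> j = 1" "j \<notin> K" "finite K" by (simp_all add: \<delta>_def K_def fin)
      ultimately show ?thesis by simp
    qed
    finally have rel: "(\<Sum>l<t. \<delta> l *\<^sub>R h l) = (\<Sum>i<s. a i *\<^sub>R w i)" using ag by simp
    define L where "L = {l \<in> supp \<beta>. \<delta> l > 0}"
    have L: "finite L" "j \<in> L" using j by (auto simp: L_def fin \<delta>_def)
    \<comment> \<open>The ratio test of linear programming: \<theta> is the longest step that keeps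
      every coefficient non-negative, and the coefficient at the minimizing index \<open>l0\<close>
      drops to 0. Since \<open>\<delta> j = 1\<close>, the set \<open>L\<close> is nonempty.\<close>
    define \<theta> where "\<theta> = Min ((\<lambda>l. \<beta> l / \<delta> l) ` L)"
    have "\<theta> \<in> (\<lambda>l. \<beta> l / \<delta> l) ` L" unfolding \<theta>_def using L by (intro Min_in) auto
    then obtain l0 where l0: "l0 \<in> L" "\<theta> = \<beta> l0 / \<delta> l0" by blast
    have \<beta>0: "0 \<le> \<beta> l" if "l < t" for l using nc that by (simp add: negative_combination_def)
    have \<theta>0: "0 \<le> \<theta>" using l0 \<beta>0[of l0] by (auto simp: L_def supp_def)
    define \<beta>' where "\<beta>' = (\<lambda>l. \<beta> l - \<theta> * \<delta> l)"
    define \<alpha>' where "\<alpha>' = (\<lambda>i. \<alpha> i + \<theta> * a i)"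
    have nn: "0 \<le> \<beta>' l" if l: "l < t" for l
    proof (cases "l \<in> L")
      case True
      then have "\<theta> \<le> \<beta> l / \<delta> l" unfolding \<theta>_def using L by (intro Min_le) auto
      then show ?thesis using True by (simp add: \<beta>'_def L_def field_simps)
    next
      case False
      then have "\<delta> l \<le> 0" by (auto simp: L_def \<delta>_def K_def split: if_splits) (use j in auto)
      then show ?thesis using \<theta>0 \<beta>0[OF l] by (simp add: \<beta>'_def mult_nonneg_nonpos)
          (smt (verit) mult_nonneg_nonpos)
    qed
    have "(\<Sum>i<s. \<alpha>' i *\<^sub>R w i) + (\<Sum>l<t. \<beta>' l *\<^sub>R h l) =
        (\<Sum>i<s. \<alpha> i *\<^sub>R w i) + (\<Sum>l<t. \<beta> l *\<^sub>R h l)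
        + \<theta> *\<^sub>R ((\<Sum>i<s. a i *\<^sub>R w i) - (\<Sum>l<t. \<delta> l *\<^sub>R h l))"
      by (simp add: \<alpha>'_def \<beta>'_def scaleR_add_left scaleR_diff_left scaleR_diff_right
          scaleR_sum_right sum.distrib sum_subtractf)
    then have nc': "negative_combination s w t h \<alpha>' \<beta>'"
      using nc nn by (simp add: rel negative_combination_def)
    have sub: "supp \<beta>' \<subseteq> supp \<beta>"
      using j by (auto simp: supp_def \<beta>'_def \<delta>_def K_def)
    have "l0 \<in> supp \<beta> - supp \<beta>'" using l0 by (auto simp: L_def supp_def \<beta>'_def)
    then have "supp \<beta>' \<subset> supp \<beta>" using sub by blast
    then have "card (supp \<beta>') < card (supp \<beta>)" by (intro psubset_card_mono fin)
    with min[OF nc'] sub J show False by auto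
  qed
  \<comment> \<open>Independence is built up one normal at a time: \<open>notin\<close> keeps each
    new \<open>h j\<close> outside the span of the \<open>w i\<close> and of the normals already
    inserted.\<close>
  have "independent (w ` {..<s} \<union> h ` K) \<and> card (w ` {..<s} \<union> h ` K) = s + card K" if "K \<subseteq> supp \<beta>" for K
  proof -
    have "finite K" using that fin finite_subset by blast
    then show ?thesis using that
    proof (induction K)
      case empty
      then show ?case using ind by (simp add: card_image[OF inj])
    next
      case (insert j K)
      have "w ` {..<s} \<union> h ` K \<subseteq> w ` {..<s} \<union> h ` (supp \<beta> - {j})" using insert by auto
      from span_mono[OF this] have "h j \<notin> span (w ` {..<s} \<union> h ` K)" using notin[of j] insert.prems by auto
      moreover have "h j \<notin> w ` {..<s} \<union> h ` K" by (metis calculation span_base)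
      moreover have IH: "independent (w ` {..<s} \<union> h ` K)" "card (w ` {..<s} \<union> h ` K) = s + card K"
        using insert.IH insert.prems by auto
      moreover have "finite (w ` {..<s} \<union> h ` K)" using insert.hyps by simp
      ultimately show ?case using insert.hyps
        unfolding image_insert Un_insert_right by (metis card_insert_disjoint independent_insertI add_Suc_right)
    qed
  qed
  from this[of "supp \<beta>"] show thesis using that[OF nc] J by (simp add: supp_def)
qed

section \<open>Rational approximation and integral domination\<close>

definition point :: "('n::finite \<Rightarrow>\<^sub>0 nat) \<Rightarrow> real ^ 'n" where
  "point b = (\<chi> i. real (Poly_Mapping.lookup b i))"

lemma point_nth [simp]: "point b $ i = real (Poly_Mapping.lookup b i)"
  by (simp add: point_def)

lemma lookup_sum_list:
  "Poly_Mapping.lookup (sum_list xs) i = (\<Sum>x\<leftarrow>xs. Poly_Mapping.lookup x i)"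
  by (induction xs) (simp_all add: lookup_add)

lemma point_sum_list: "point (sum_list xs) = (\<Sum>x\<leftarrow>xs. point x)"
  by (induction xs) (simp_all add: vec_eq_iff lookup_add)

lemma list_with_multiplicities:
  fixes m :: "('n \<Rightarrow>\<^sub>0 nat) \<Rightarrow> nat"
  assumes "finite F"
  obtains gs where "set gs \<subseteq> F" "length gs = sum m F"
    "\<And>i. Poly_Mapping.lookup (sum_list gs) i = (\<Sum>g\<in>F. m g * Poly_Mapping.lookup g i)"
proof -
  from assms have "\<exists>gs. set gs \<subseteq> F \<and> length gs = sum m F \<and>
    (\<forall>i. Poly_Mapping.lookup (sum_list gs) i = (\<Sum>g\<in>F. m g * Poly_Mapping.lookup g i))"
  proof (induction F)
    case (insert x F)
    then obtain gs where "set gs \<subseteq> F" "length gs = sum m F"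
      "\<forall>i. Poly_Mapping.lookup (sum_list gs) i = (\<Sum>g\<in>F. m g * Poly_Mapping.lookup g i)"
      by blast
    with insert.hyps show ?case
      by (intro exI[of _ "replicate (m x) x @ gs"])
        (auto simp: lookup_add lookup_sum_list sum_list_replicate)
  qed simp
  with that show thesis by blast
qed

text \<open>The coefficients of \<open>e\<close> as a convex combination may be irrational.
  Simultaneous Dirichlet approximation replaces them by fractions with one denominator
  \<open>q\<close>, with so small an error that integrality restores every inequality. In terms of
  monomials, a product of \<open>N * length us\<close> monomials from \<open>B\<close> properly
  divides the \<open>N\<close>-th power of the product over \<open>us\<close>.\<close>

lemma integral_dominance:
  fixes B :: "('n::finite \<Rightarrow>\<^sub>0 nat) set"
  assumes e: "e \<in> convex hull (point ` B)"
    and le: "\<And>i. real (length us) * e $ i \<le> real (Poly_Mapping.lookup (sum_list us) i)"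
    and less: "real (length us) * e $ i0 < real (Poly_Mapping.lookup (sum_list us) i0)"
  obtains N gs y where "N > 0" "set gs \<subseteq> B" "length gs = N * length us"
    "sum_list gs + y = sum_list (concat (replicate N us))" "y \<noteq> 0"
proof -
  define m where "m = length us"
  define D where "D = (\<lambda>i. Poly_Mapping.lookup (sum_list us) i)"
  obtain F \<mu> where F: "finite F" "F \<subseteq> B" and \<mu>: "\<And>g. g \<in> F \<Longrightarrow> 0 \<le> \<mu> g" "sum \<mu> F = 1"
    "(\<Sum>g\<in>F. \<mu> g *\<^sub>R point g) = e"
  proof -
    from e obtain S u where S: "finite S" "S \<subseteq> point ` B" "\<forall>x\<in>S. 0 \<le> u x" "sum u S = 1"
      "(\<Sum>v\<in>S. u v *\<^sub>R v) = e"
      unfolding convex_hull_explicit by blast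
    moreover from this obtain F where "F \<subseteq> B" "finite F" "S = point ` F"
      by (meson finite_subset_image)
    moreover have "inj_on point F"
      by (rule inj_onI) (auto simp: vec_eq_iff intro: poly_mapping_eqI)
    ultimately show thesis
      by (intro that[of F "u \<circ> point"]) (auto simp: sum.reindex)
  qed
  have ei: "e $ i = (\<Sum>g\<in>F. \<mu> g * real (Poly_Mapping.lookup g i))" for i
    by (simp add: \<mu>(3)[symmetric])
  define H where "H = (\<Sum>g\<in>F. \<Sum>i\<in>UNIV. Poly_Mapping.lookup g i)"
  have H: "Poly_Mapping.lookup g i \<le> H" if "g \<in> F" for g i
  proof -
    have "Poly_Mapping.lookup g i \<le> (\<Sum>i\<in>UNIV. Poly_Mapping.lookup g i)"
      by (rule member_le_sum) auto
    also have "\<dots> \<le> H" unfolding H_def using that F by (intro member_le_sum) auto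
    finally show ?thesis .
  qed
  \<comment> \<open>The slack at \<open>i0\<close>, capped at 1 so that an error below \<delta> can
    be removed by integrality.\<close>
  define \<delta> where "\<delta> = min 1 (real (D i0) - real m * e $ i0)"
  have \<delta>: "0 < \<delta>" "\<delta> \<le> 1" using less by (auto simp: \<delta>_def D_def m_def)
  \<comment> \<open>\<open>M / P\<close> bounds both the error in each coordinate of
    \<open>m\<close> times the weighted sum and, through the summand 1, the error in the sum of the
    weights.\<close>
  define M where "M = real (card F) * (real m * real H + 1)"
  obtain P :: nat where P: "P > 0" "M / \<delta> < real P"
    by (metis reals_Archimedean2 gr0I of_nat_0_less_iff less_trans not_less_iff_gr_or_eq zero_less_Suc lessI of_nat_less_iff)
  then have MP: "M / real P < \<delta>" using \<delta> by (simp add: field_simps)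
  obtain f where f: "bij_betw f {..<card F} F"
    using ex_bij_betw_nat_finite[OF F(1)] by (auto simp: atLeast0LessThan)
  obtain q p' where q: "0 < q" and p': "\<And>i. i < card F \<Longrightarrow> \<bar>of_int q * \<mu> (f i) - of_int (p' i)\<bar> < 1 / real P"
    by (rule Dirichlet_approx_simult[OF P(1), where n = "card F" and \<theta> = "\<mu> \<circ> f"]) auto
  define p where "p = (\<lambda>g. p' (the_inv_into {..<card F} f g))"
  have p: "\<bar>of_int q * \<mu> g - of_int (p g)\<bar> < 1 / real P" if "g \<in> F" for g
    using p'[of "the_inv_into {..<card F} f g"] that f
    by (metis bij_betw_def f_the_inv_into_f lessThan_iff p_def the_inv_into_into order_refl)
  have approx: "\<bar>of_int q * (\<Sum>g\<in>F. \<mu> g * x g) - (\<Sum>g\<in>F. of_int (p g) * x g)\<bar> \<le> real (card F) * X / real P"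
    if x: "\<And>g. g \<in> F \<Longrightarrow> 0 \<le> x g" "\<And>g. g \<in> F \<Longrightarrow> x g \<le> X" for x :: "_ \<Rightarrow> real" and X
  proof -
    have "\<bar>of_int q * (\<Sum>g\<in>F. \<mu> g * x g) - (\<Sum>g\<in>F. of_int (p g) * x g)\<bar> =
        \<bar>\<Sum>g\<in>F. (of_int q * \<mu> g - of_int (p g)) * x g\<bar>"
      by (simp add: sum_distrib_left left_diff_distrib sum_subtractf mult.assoc)
    also have "\<dots> \<le> (\<Sum>g\<in>F. \<bar>(of_int q * \<mu> g - of_int (p g)) * x g\<bar>)" by (rule sum_abs)
    also have "\<dots> \<le> (\<Sum>g\<in>F. 1 / real P * X)"
      unfolding abs_mult using x p by (intro sum_mono mult_mono) (auto intro: less_imp_le)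
    finally show ?thesis by simp
  qed
  have c0: "0 \<le> real (card F) * (real m * real H)" by simp
  \<comment> \<open>As \<open>F\<close> is nonempty here, \<open>M\<close> is at least 1, so the
    approximation error is below 1 and each numerator is an integer above -1.\<close>
  have p0: "0 \<le> p g" if g: "g \<in> F" for g
  proof -
    have "1 \<le> card F" using F(1) g by (simp add: Suc_le_eq card_gt_0_iff) blast
    then have "1 \<le> M" using c0 unfolding M_def distrib_left by linarith
    then have "1 / real P \<le> M / real P" by (simp add: divide_right_mono)
    then have "1 / real P < 1" using MP \<delta> by simp
    moreover have "0 \<le> of_int q * \<mu> g" using q \<mu>(1)[OF g] by simp
    ultimately have "of_int (p g) > (-1::real)" using p[OF g] by linarith
    then show ?thesis by linarith
  qed
  \<comment> \<open>Both sides are integers at distance below 1, so the numerators add up to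
    \<open>q\<close> exactly. This gives the two products equally many factors.\<close>
  have sump: "sum p F = q"
  proof -
    have "\<bar>of_int q * (\<Sum>g\<in>F. \<mu> g * 1) - (\<Sum>g\<in>F. of_int (p g) * 1)\<bar> \<le> real (card F) * 1 / real P"
      by (rule approx) auto
    also have "\<dots> \<le> M / real P" unfolding M_def distrib_left using c0 by (intro divide_right_mono) linarith+
    also have "\<dots> < 1" using MP \<delta> by simp
    finally have "\<bar>of_int (q - sum p F)\<bar> < (1::real)" using \<mu>(2) by simp
    then show ?thesis by linarith
  qed
  have est: "real m * (\<Sum>g\<in>F. of_int (p g) * real (Poly_Mapping.lookup g i)) < of_int q * (real m * e $ i) + \<delta>" for i
  proof -
    have "\<bar>of_int q * e $ i - (\<Sum>g\<in>F. of_int (p g) * real (Poly_Mapping.lookup g i))\<bar> \<le> real (card F) * real H / real P"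
      unfolding ei by (rule approx) (auto simp: H)
    then have "real m * (\<Sum>g\<in>F. of_int (p g) * real (Poly_Mapping.lookup g i)) \<le> real m * (of_int q * e $ i + real (card F) * real H / real P)"
      by (intro mult_left_mono) auto
    also have "\<dots> = of_int q * (real m * e $ i) + real (card F) * (real m * real H) / real P"
      by (simp add: algebra_simps)
    also have "real (card F) * (real m * real H) / real P \<le> M / real P"
      unfolding M_def by (intro divide_right_mono mult_left_mono) auto
    finally show ?thesis using MP by linarith
  qed
  define n where "n = (\<lambda>g. m * nat (p g))"
  obtain gs where gs: "set gs \<subseteq> F" "length gs = sum n F"
    "\<And>i. Poly_Mapping.lookup (sum_list gs) i = (\<Sum>g\<in>F. n g * Poly_Mapping.lookup g i)"
    using list_with_multiplicities[OF F(1)] by blast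
  have lg: "real (Poly_Mapping.lookup (sum_list gs) i) = real m * (\<Sum>g\<in>F. of_int (p g) * real (Poly_Mapping.lookup g i))" for i
    unfolding gs by (simp add: n_def sum_distrib_left mult.assoc p0)
  define N where "N = nat q"
  have lu: "Poly_Mapping.lookup (sum_list (concat (replicate N us))) i = N * D i" for i
    by (induction N) (simp_all add: lookup_add D_def)
  have qN: "of_int q = real N" using q by (simp add: N_def)
  have le1: "Poly_Mapping.lookup (sum_list gs) i \<le> N * D i" for i
  proof -
    have "real (Poly_Mapping.lookup (sum_list gs) i) < real N * (real m * e $ i) + 1"
      using est[of i] \<delta> unfolding lg qN by linarith
    also have "real N * (real m * e $ i) \<le> real N * real (D i)"
      using le[of i] by (intro mult_left_mono) (auto simp: m_def D_def)
    finally have "real (Poly_Mapping.lookup (sum_list gs) i) < real (N * D i + 1)" by simp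
    then show ?thesis by linarith
  qed
  have less1: "Poly_Mapping.lookup (sum_list gs) i0 < N * D i0"
  proof -
    have "real (Poly_Mapping.lookup (sum_list gs) i0) < real N * (real m * e $ i0) + \<delta>"
      using est[of i0] unfolding lg qN by linarith
    \<comment> \<open>The error stays below \<delta> whatever \<open>N\<close> is, whereas the slack
      at \<open>i0\<close> is multiplied by \<open>N\<close>.\<close>
    moreover have "1 * \<delta> \<le> real N * \<delta>" using q \<delta> by (intro mult_right_mono) (auto simp: N_def)
    moreover have "real N * (real m * e $ i0 + \<delta>) \<le> real N * real (D i0)"
      by (intro mult_left_mono) (auto simp: \<delta>_def)
    ultimately have "real (Poly_Mapping.lookup (sum_list gs) i0) < real N * real (D i0)"
      by (simp add: distrib_left)
    then show ?thesis by (metis of_nat_less_iff of_nat_mult)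
  qed
  \<comment> \<open>Subtraction of exponents is truncated at 0; \<open>le1\<close> makes it a true
    difference and \<open>less1\<close> makes it non-zero.\<close>
  show thesis
  proof (rule that[of N gs "sum_list (concat (replicate N us)) - sum_list gs"])
    show "N > 0" using q by (simp add: N_def)
    show "set gs \<subseteq> B" using gs F by blast
    have "int (sum (\<lambda>g. nat (p g)) F) = q" using sump p0 by simp
    then have "sum (\<lambda>g. nat (p g)) F = nat q" by (metis nat_int)
    then show "length gs = N * length us"
      by (simp add: gs n_def sum_distrib_left[symmetric] N_def m_def)
    show "sum_list gs + (sum_list (concat (replicate N us)) - sum_list gs) = sum_list (concat (replicate N us))"
      using le1 by (intro poly_mapping_eqI) (simp add: lookup_add lookup_minus lu)
    have "Poly_Mapping.lookup (sum_list (concat (replicate N us)) - sum_list gs) i0 \<noteq> 0"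
      using less1 by (simp add: lookup_minus lu)
    then show "sum_list (concat (replicate N us)) - sum_list gs \<noteq> 0" by auto
  qed
qed

section \<open>Counting products of generators\<close>

definition list_sums :: "('n \<Rightarrow>\<^sub>0 nat) set \<Rightarrow> nat \<Rightarrow> (('n \<Rightarrow>\<^sub>0 nat) \<times> nat) set" where
  "list_sums T N = (\<lambda>us. (sum_list us, length us)) ` {us. set us \<subseteq> T \<and> length us \<le> N}"

lemma finite_list_sums: "finite T \<Longrightarrow> finite (list_sums T N)"
  unfolding list_sums_def using finite_lists_length_le by auto

text \<open>The pairs in \<open>list_sums T N\<close> are the exponents \<open>(u, j)\<close> of the
  products of at most \<open>N\<close> elements \<open>x^b t\<close> with \<open>b\<close> in
  \<open>T\<close>. Each form in \<open>U\<close> takes on \<open>u\<close> the value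
  \<open>j\<close> times a constant, so \<open>u\<close> is determined by \<open>j\<close> and by
  the coordinates whose unit vectors complete \<open>U\<close> to a basis. Each of these numbers
  grows at most linearly in \<open>N\<close>.\<close>

lemma card_list_sums:
  fixes T :: "('n::finite \<Rightarrow>\<^sub>0 nat) set" and U :: "(real ^ 'n) set"
  assumes T: "finite T" and U: "independent U" and const: "\<And>v. v \<in> U \<Longrightarrow> \<exists>d. \<forall>b\<in>T. v \<bullet> point b = d"
  shows "\<exists>C. \<forall>N. card (list_sums T N) \<le> (C * N + 1) ^ (CARD('n) - card U + 1)"
proof -
  have axes: "Basis = range (\<lambda>i::'n. axis i (1::real))" by (auto simp: Basis_vec_def)
  obtain B where B: "U \<subseteq> B" "B \<subseteq> U \<union> Basis" "independent B" "U \<union> Basis \<subseteq> span B"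
    by (rule maximal_independent_subset_extend[of U "U \<union> Basis"]) (use U in auto)
  have spanB: "span B = UNIV"
    using span_minimal[of Basis "span B"] B(4) by (auto simp: span_Basis)
  have finB: "finite B" using B(3) by (rule independent_imp_finite)
  have cardB: "card B = CARD('n)"
    using dim_eq_card_independent[OF B(3)] dim_span[of B] by (simp add: spanB)
  define R where "R = {i::'n. axis i 1 \<in> B - U}"
  have "card R = card (B - U)"
  proof (rule bij_betw_same_card)
    show "bij_betw (\<lambda>i. axis i (1::real)) R (B - U)"
      unfolding bij_betw_def using B(2) by (auto simp: inj_on_def R_def axis_eq_axis axes)
  qed
  also have "\<dots> = CARD('n) - card U"
    using card_Diff_subset[of U B] B(1) finB by (simp add: finite_subset cardB)
  finally have cardR: "card R = CARD('n) - card U" .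
  obtain d where d: "\<And>v b. v \<in> U \<Longrightarrow> b \<in> T \<Longrightarrow> v \<bullet> point b = d v"
    using const by metis
  have dsum: "v \<bullet> point (sum_list us) = real (length us) * d v" if "v \<in> U" "set us \<subseteq> T" for v us
    using that(2)
  proof (induction us)
    case Nil
    have "point (0 :: 'n \<Rightarrow>\<^sub>0 nat) = 0" by (simp add: vec_eq_iff)
    then show ?case by simp
  next
    case (Cons a us)
    moreover have "point (sum_list (a # us)) = point a + point (sum_list us)"
      by (simp add: vec_eq_iff lookup_add)
    ultimately show ?case by (simp add: inner_add_right d[OF that(1)] distrib_right del: sum_list.Cons)
  qed
  define M where "M = (\<Sum>b\<in>T. \<Sum>i\<in>UNIV. Poly_Mapping.lookup b i)"
  have M: "Poly_Mapping.lookup b i \<le> M" if "b \<in> T" for b i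
  proof -
    have "Poly_Mapping.lookup b i \<le> (\<Sum>i\<in>UNIV. Poly_Mapping.lookup b i)"
      by (rule member_le_sum) auto
    also have "\<dots> \<le> M" unfolding M_def using that T by (intro member_le_sum) auto
    finally show ?thesis .
  qed
  define \<phi> where "\<phi> = (\<lambda>(u :: 'n \<Rightarrow>\<^sub>0 nat, j :: nat). (j, restrict (Poly_Mapping.lookup u) R))"
  have card_le: "card (list_sums T N) \<le> ((M + 1) * N + 1) ^ (CARD('n) - card U + 1)" for N
  proof -
    have "inj_on \<phi> (list_sums T N)"
    proof (rule inj_onI)
      fix x y assume "x \<in> list_sums T N" "y \<in> list_sums T N" and eq: "\<phi> x = \<phi> y"
      then obtain us vs where x: "x = (sum_list us, length us)" "set us \<subseteq> T"
        and y: "y = (sum_list vs, length vs)" "set vs \<subseteq> T" by (auto simp: list_sums_def)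
      have len: "length us = length vs" using eq by (simp add: x y \<phi>_def)
      define z where "z = point (sum_list us) - point (sum_list vs)"
      have "v \<bullet> z = 0" if vB: "v \<in> B" for v
      proof (cases "v \<in> U")
        case True
        then show ?thesis using len by (simp add: z_def inner_diff_right dsum x y)
      next
        case False
        then obtain i where i: "v = axis i 1" using B(2) vB False by (auto simp: axes)
        then have "i \<in> R" using False vB by (simp add: R_def)
        then have "Poly_Mapping.lookup (sum_list us) i = Poly_Mapping.lookup (sum_list vs) i"
          using eq by (auto simp: x y \<phi>_def restrict_def fun_eq_iff) metis
        then show ?thesis by (simp add: i inner_axis' z_def)
      qed
      then have "orthogonal z v" if "v \<in> B" for v using that by (simp add: orthogonal_def inner_commute)
      then have "orthogonal z z" using orthogonal_to_span[of z B z] spanB by auto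
      then have "sum_list us = sum_list vs"
        by (intro poly_mapping_eqI) (simp add: orthogonal_def z_def vec_eq_iff)
      then show "x = y" by (simp add: x y len)
    qed
    moreover have "\<phi> ` list_sums T N \<subseteq> {..N} \<times> (\<Pi>\<^sub>E i\<in>R. {..N * M})"
    proof
      fix z assume "z \<in> \<phi> ` list_sums T N"
      then obtain us where us: "z = \<phi> (sum_list us, length us)" "set us \<subseteq> T" "length us \<le> N"
        by (auto simp: list_sums_def)
      have "Poly_Mapping.lookup (sum_list us) i \<le> N * M" for i
      proof -
        have "Poly_Mapping.lookup (sum_list us) i \<le> length us * M" using us(2)
          by (induction us) (auto simp: lookup_add M intro: add_mono)
        also have "\<dots> \<le> N * M" using us(3) by simp
        finally show ?thesis .
      qed
      then show "z \<in> {..N} \<times> (\<Pi>\<^sub>E i\<in>R. {..N * M})" using us by (auto simp: \<phi>_def)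
    qed
    ultimately have "card (list_sums T N) \<le> card ({..N} \<times> (\<Pi>\<^sub>E i\<in>R. {..N * M}))"
      by (intro card_inj_on_le) (auto intro!: finite_PiE)
    also have "\<dots> = (N + 1) * (N * M + 1) ^ card R" by (simp add: card_cartesian_product card_PiE)
    also have "\<dots> \<le> ((M + 1) * N + 1) * ((M + 1) * N + 1) ^ card R"
      by (intro mult_mono power_mono) auto
    finally show ?thesis by (simp add: cardR)
  qed
  then show "\<exists>C. \<forall>N. card (list_sums T N) \<le> (C * N + 1) ^ (CARD('n) - card U + 1)" by blast
qed

text \<open>If the normals active at the barycenter of \<open>us\<close> gave no negative
  combination, the alternative would yield a direction in which the barycenter can be decreased
  inside the polytope, against \<open>undominated\<close>. Minimality of \<open>k\<close> bounds the
  support of the combination from below, and the active normals are constant on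
  \<open>us\<close>.\<close>

lemma active_normals:
  fixes B :: "('n::finite \<Rightarrow>\<^sub>0 nat) set" and w h :: "nat \<Rightarrow> real ^ 'n"
  assumes desc: "halfspace_description (convex hull (point ` B)) s w b t h c"
    and ex: "\<exists>\<alpha> \<beta>. negative_combination s w t h \<alpha> \<beta>"
    and k: "k = (LEAST m. \<exists>\<alpha> \<beta>. negative_combination s w t h \<alpha> \<beta> \<and> m = card {j. j < t \<and> \<beta> j \<noteq> 0})"
    and us: "set us \<subseteq> B"
    and undominated: "\<And>N gs y. N > 0 \<Longrightarrow> set gs \<subseteq> B \<Longrightarrow> length gs = N * length us \<Longrightarrow>
      sum_list gs + y = sum_list (concat (replicate N us)) \<Longrightarrow> y = 0"
  obtains U :: "(real ^ 'n) set" where "independent U" "s + k \<le> card U"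
    "\<And>v. v \<in> U \<Longrightarrow> \<exists>d. \<forall>b\<in>set us. v \<bullet> point b = d"
proof -
  define E where "E = convex hull (point ` B)"
  have inj: "inj_on w {..<s}" and ind: "independent (w ` {..<s})"
    using desc by (auto simp: halfspace_description_def minimal_hyperplanes_def)
  have E: "x \<in> E \<longleftrightarrow> (\<forall>i<s. w i \<bullet> x = b i) \<and> (\<forall>j<t. h j \<bullet> x \<le> c j)" for x
    using desc unfolding halfspace_description_def E_def[symmetric] by auto
  have mem: "point g \<in> E" if "g \<in> set us" for g
    using us that unfolding E_def by (intro hull_inc) auto
  have "\<exists>J. (\<exists>\<alpha> \<beta>. negative_combination s w t h \<alpha> \<beta> \<and> (\<forall>j<t. j \<notin> J \<longrightarrow> \<beta> j = 0)) \<and>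
    (\<forall>j\<in>J. j < t \<longrightarrow> (\<forall>g\<in>set us. h j \<bullet> point g = c j))"
  proof (cases "us = []")
    case True
    \<comment> \<open>For the empty list activity is vacuous, so every halfspace may be
      used.\<close>
    then show ?thesis using ex by (intro exI[of _ UNIV]) auto
  next
    case False
    define m where "m = real (length us)"
    have m: "m > 0" using False by (simp add: m_def)
    define \<sigma> where "\<sigma> = (1 / m) *\<^sub>R point (sum_list us)"
    have inner_\<sigma>: "m * (v \<bullet> \<sigma>) = (\<Sum>g\<leftarrow>us. v \<bullet> point g)" for v
    proof -
      have "v \<bullet> (\<Sum>g\<leftarrow>us. point g) = (\<Sum>g\<leftarrow>us. v \<bullet> point g)"
        by (induction us) (simp_all add: inner_add_right)
      then show ?thesis using m by (simp add: \<sigma>_def point_sum_list)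
    qed
    have w\<sigma>: "w i \<bullet> \<sigma> = b i" if "i < s" for i
    proof -
      have "m * (w i \<bullet> \<sigma>) = (\<Sum>g\<leftarrow>us. b i)"
        unfolding inner_\<sigma> using mem that by (intro arg_cong[where f = sum_list] map_cong) (auto simp: E)
      also have "\<dots> = m * b i" by (simp add: sum_list_triv m_def)
      finally show ?thesis using m by simp
    qed
    have h\<sigma>_gap: "m * (c j - h j \<bullet> \<sigma>) = (\<Sum>g\<leftarrow>us. c j - h j \<bullet> point g)" for j
      unfolding right_diff_distrib inner_\<sigma> sum_list_subtractf by (simp add: sum_list_triv m_def)
    have gap: "0 \<le> c j - h j \<bullet> point g" if "g \<in> set us" "j < t" for g j
      using mem that by (auto simp: E)
    define J where "J = {j. h j \<bullet> \<sigma> = c j}"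
    \<comment> \<open>Non-negative gaps with sum 0 all vanish: a halfspace active at the barycenter
      is active at each of the points.\<close>
    have act: "h j \<bullet> point g = c j" if j: "j \<in> J" "j < t" and g: "g \<in> set us" for j g
    proof -
      have "(\<Sum>g\<leftarrow>us. c j - h j \<bullet> point g) = 0" using h\<sigma>_gap[of j] j by (simp add: J_def)
      then have "\<forall>x \<in> set (map (\<lambda>g. c j - h j \<bullet> point g) us). x = 0"
        using gap j(2) by (subst (asm) sum_list_nonneg_eq_0_iff) auto
      then show ?thesis using g by auto
    qed
    have strict: "h j \<bullet> \<sigma> < c j" if "j < t" "j \<notin> J" for j
    proof -
      have "0 \<le> m * (c j - h j \<bullet> \<sigma>)"
        unfolding h\<sigma>_gap using gap that by (intro sum_list_nonneg) auto
      then have "0 \<le> c j - h j \<bullet> \<sigma>" using m by (simp add: zero_le_mult_iff)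
      then show ?thesis using that by (simp add: J_def)
    qed
    show ?thesis
    proof (cases rule: negative_combination_alternative[of s w t h J])
      case (combination \<alpha> \<beta>)
      then show ?thesis using act by blast
    next
      \<comment> \<open>A small step from \<sigma> against \<open>y\<close> stays in the polytope:
        the inactive inequalities are strict at \<sigma>, the active ones survive because
        \<open>h j \<bullet> y\<close> is non-negative, and the equations because
        \<open>w i \<bullet> y\<close> is 0. As \<open>y\<close> is non-negative and non-zero, the
        new point is dominated by \<sigma>.\<close>
      case (direction y)
      have "\<forall>\<^sub>F \<epsilon> in at_right 0. \<forall>j\<in>{..<t} - J. h j \<bullet> \<sigma> - \<epsilon> * (h j \<bullet> y) < c j"
      proof (intro eventually_ball_finite ballI)
        fix j assume "j \<in> {..<t} - J"
        then have "h j \<bullet> \<sigma> - 0 * (h j \<bullet> y) < c j" using strict by auto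
        moreover have "((\<lambda>\<epsilon>. h j \<bullet> \<sigma> - \<epsilon> * (h j \<bullet> y)) \<longlongrightarrow> h j \<bullet> \<sigma> - 0 * (h j \<bullet> y)) (at_right 0)"
          by (intro tendsto_intros)
        ultimately show "\<forall>\<^sub>F \<epsilon> in at_right 0. h j \<bullet> \<sigma> - \<epsilon> * (h j \<bullet> y) < c j"
          by (rule order_tendstoD(2)[rotated])
      qed simp
      moreover have "\<forall>\<^sub>F \<epsilon> in at_right (0::real). 0 < \<epsilon>"
        by (simp add: eventually_at_right_less)
      ultimately have "\<forall>\<^sub>F \<epsilon> in at_right 0. 0 < \<epsilon> \<and> (\<forall>j\<in>{..<t} - J. h j \<bullet> \<sigma> - \<epsilon> * (h j \<bullet> y) < c j)"
        by eventually_elim auto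
      then obtain \<epsilon> where \<epsilon>: "0 < \<epsilon>" "\<forall>j\<in>{..<t} - J. h j \<bullet> \<sigma> - \<epsilon> * (h j \<bullet> y) < c j"
        using eventually_happens[of _ "at_right (0::real)"] by auto
      define e where "e = \<sigma> - \<epsilon> *\<^sub>R y"
      have eE: "e \<in> E"
        unfolding E
      proof (intro conjI allI impI)
        fix i assume "i < s"
        then show "w i \<bullet> e = b i" using w\<sigma> direction by (simp add: e_def inner_diff_right)
      next
        fix j assume j: "j < t"
        show "h j \<bullet> e \<le> c j"
        proof (cases "j \<in> J")
          case True
          then have "0 \<le> \<epsilon> * (h j \<bullet> y)" using \<epsilon>(1) direction(4)[OF j True] by simp
          then show ?thesis using True by (simp add: e_def inner_diff_right J_def)
        next
          case False
          then show ?thesis using \<epsilon>(2) j by (auto simp: e_def inner_diff_right less_imp_le)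
        qed
      qed
      obtain i0 where "y $ i0 \<noteq> 0" using direction(1) by (auto simp: vec_eq_iff)
      then have i0: "y $ i0 > 0" using direction(2)[of i0] by simp
      have me: "m * e $ i = real (Poly_Mapping.lookup (sum_list us) i) - m * (\<epsilon> * y $ i)" for i
        using m by (simp add: e_def \<sigma>_def right_diff_distrib)
      have "real (length us) * e $ i \<le> real (Poly_Mapping.lookup (sum_list us) i)" for i
        using me[of i] m \<epsilon>(1) direction(2)[of i] by (simp add: m_def)
      moreover have "real (length us) * e $ i0 < real (Poly_Mapping.lookup (sum_list us) i0)"
      proof -
        have "m * (\<epsilon> * y $ i0) > 0" using m \<epsilon> i0 by simp
        then show ?thesis using me[of i0] by (simp add: m_def)
      qed
      ultimately obtain N gs y where "N > 0" "set gs \<subseteq> B" "length gs = N * length us"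
          "sum_list gs + y = sum_list (concat (replicate N us))" "y \<noteq> 0"
        using integral_dominance[OF eE[unfolded E_def]] by metis
      with undominated show ?thesis by blast
    qed
  qed
  then obtain J \<alpha>0 \<beta>0 where nc: "negative_combination s w t h \<alpha>0 \<beta>0" "\<And>j. j < t \<Longrightarrow> j \<notin> J \<Longrightarrow> \<beta>0 j = 0"
    and J: "\<And>j g. j \<in> J \<Longrightarrow> j < t \<Longrightarrow> g \<in> set us \<Longrightarrow> h j \<bullet> point g = c j" by blast
  obtain \<alpha> \<beta> where ab: "negative_combination s w t h \<alpha> \<beta>" "{j. j < t \<and> \<beta> j \<noteq> 0} \<subseteq> J"
    "independent (w ` {..<s} \<union> h ` {j. j < t \<and> \<beta> j \<noteq> 0})"
    "card (w ` {..<s} \<union> h ` {j. j < t \<and> \<beta> j \<noteq> 0}) = s + card {j. j < t \<and> \<beta> j \<noteq> 0}"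
    using independent_negative_support[OF inj ind nc] by blast
  show thesis
  proof (rule that[OF ab(3)])
    have "k \<le> card {j. j < t \<and> \<beta> j \<noteq> 0}" unfolding k using ab(1) by (intro Least_le) blast
    then show "s + k \<le> card (w ` {..<s} \<union> h ` {j. j < t \<and> \<beta> j \<noteq> 0})" unfolding ab(4) by simp
    fix v assume "v \<in> w ` {..<s} \<union> h ` {j. j < t \<and> \<beta> j \<noteq> 0}"
    then show "\<exists>d. \<forall>b\<in>set us. v \<bullet> point b = d"
      using mem J ab(2) by (auto simp: E)
  qed
qed

section \<open>Chains of primes and growth\<close>

text \<open>Prime ideals of a subring \<open>A\<close>, written with the type class operations of
  the ambient ring so that its sums and powers apply without record syntax.\<close>

definition prime_in :: "'r::comm_ring_1 set \<Rightarrow> 'r set \<Rightarrow> bool" where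
  "prime_in A Q \<longleftrightarrow> Q \<subseteq> A \<and> 0 \<in> Q \<and> (\<forall>x\<in>Q. \<forall>y\<in>Q. x + y \<in> Q) \<and> (\<forall>a\<in>A. \<forall>x\<in>Q. a * x \<in> Q) \<and>
     1 \<notin> Q \<and> (\<forall>x\<in>A. \<forall>y\<in>A. x * y \<in> Q \<longrightarrow> x \<in> Q \<or> y \<in> Q)"

lemma prime_inD:
  assumes "prime_in A Q"
  shows "Q \<subseteq> A" "0 \<in> Q" "\<And>x y. x \<in> Q \<Longrightarrow> y \<in> Q \<Longrightarrow> x + y \<in> Q" "\<And>a x. a \<in> A \<Longrightarrow> x \<in> Q \<Longrightarrow> a * x \<in> Q"
    "1 \<notin> Q" "\<And>x y. x \<in> A \<Longrightarrow> y \<in> A \<Longrightarrow> x * y \<in> Q \<Longrightarrow> x \<in> Q \<or> y \<in> Q"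
  using assms unfolding prime_in_def by blast+

text \<open>Gaussian elimination: a pivot unknown \<open>p\<close> is eliminated with the help of
  one equation, which leaves one equation and one unknown fewer.\<close>

lemma homogeneous_system_solution:
  fixes M :: "'a \<Rightarrow> 'b \<Rightarrow> 'k::field"
  assumes "finite L" "finite X" "card L < card X"
  obtains x where "\<exists>a\<in>X. x a \<noteq> 0" "\<And>l. l \<in> L \<Longrightarrow> (\<Sum>a\<in>X. x a * M a l) = 0"
proof -
  from assms have "\<exists>x. (\<exists>a\<in>X. x a \<noteq> 0) \<and> (\<forall>l\<in>L. (\<Sum>a\<in>X. x a * M a l) = 0)"
  proof (induction L arbitrary: X M)
    case empty
    then have "X \<noteq> {}" by auto
    then show ?case by (intro exI[of _ "\<lambda>_. 1"]) auto
  next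
    case (insert l L)
    show ?case
    proof (cases "\<forall>a\<in>X. M a l = 0")
      case True
      have "card L < card X" using insert.prems(2) insert.hyps by simp
      from insert.IH[OF insert.prems(1) this, of M] True show ?thesis by auto
    next
      case False
      then obtain p where p: "p \<in> X" "M p l \<noteq> 0" by blast
      define X' where "X' = X - {p}"
      have X': "X = insert p X'" "p \<notin> X'" "finite X'" using p insert.prems by (auto simp: X'_def)
      have "card L < card X'" using insert.prems(2) insert.hyps X' by simp
      from insert.IH[OF X'(3) this, of "\<lambda>a l'. M a l' - M a l / M p l * M p l'"]
      obtain x where x: "\<exists>a\<in>X'. x a \<noteq> 0"
        "\<And>l'. l' \<in> L \<Longrightarrow> (\<Sum>a\<in>X'. x a * (M a l' - M a l / M p l * M p l')) = 0" by blast
      \<comment> \<open>The value at the pivot is forced by the equation \<open>l\<close>; inserted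
        in the other equations it yields the reduced ones.\<close>
      define r where "r = - (\<Sum>a\<in>X'. x a * M a l) / M p l"
      define z where "z = (\<lambda>a. if a = p then r else x a)"
      have eq: "(\<Sum>a\<in>X. z a * M a l') = r * M p l' + (\<Sum>a\<in>X'. x a * M a l')" for l'
      proof -
        have "(\<Sum>a\<in>X'. z a * M a l') = (\<Sum>a\<in>X'. x a * M a l')"
          using X' by (intro sum.cong) (auto simp: z_def)
        then show ?thesis using X' by (simp add: z_def)
      qed
      have "(\<Sum>a\<in>X. z a * M a l') = 0" if "l' \<in> insert l L" for l'
      proof (cases "l' = l")
        case True
        then show ?thesis using p by (simp add: eq r_def)
      next
        case False
        have "r * M p l' = (\<Sum>a\<in>X'. x a * - (M a l / M p l * M p l'))"
          by (simp add: r_def sum_distrib_right sum_divide_distrib sum_negf mult.assoc)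
        then have "(\<Sum>a\<in>X. z a * M a l') = (\<Sum>a\<in>X'. x a * (M a l' - M a l / M p l * M p l'))"
          unfolding eq by (simp add: sum.distrib[symmetric] algebra_simps)
        then show ?thesis using x(2) that False by simp
      qed
      moreover have "\<exists>a\<in>X. z a \<noteq> 0" using x(1) X' by (auto simp: z_def)
      ultimately show ?thesis by blast
    qed
  qed
  with that show thesis by blast
qed

definition power_product :: "'r::comm_monoid_mult list \<Rightarrow> nat list \<Rightarrow> 'r" where
  "power_product ys e = prod_list (map2 (^) ys e)"

lemma power_product_simps [simp]:
  "power_product [] e = 1"
  "power_product (y # ys) (a # e) = y ^ a * power_product ys e"
  by (simp_all add: power_product_def)

text \<open>An algebra over a field, carried by a subset of a ring and with structure map \<kappa>.
  Membership of 0 and 1 comes from the scalars.\<close>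

locale subalgebra =
  fixes A :: "'r::comm_ring_1 set" and \<kappa> :: "'k::field \<Rightarrow> 'r"
  assumes add_closed: "x \<in> A \<Longrightarrow> y \<in> A \<Longrightarrow> x + y \<in> A"
    and mult_closed: "x \<in> A \<Longrightarrow> y \<in> A \<Longrightarrow> x * y \<in> A"
    and scalar_closed: "\<kappa> c \<in> A"
    and scalar_add: "\<kappa> (c + d) = \<kappa> c + \<kappa> d"
    and scalar_mult: "\<kappa> (c * d) = \<kappa> c * \<kappa> d"
    and scalar_one: "\<kappa> 1 = 1"
begin

lemma scalar_zero: "\<kappa> 0 = 0"
  using scalar_add[of 0 0] by simp

lemma scalar_uminus: "\<kappa> (- c) = - \<kappa> c"
  using scalar_add[of "- c" c] by (simp add: scalar_zero eq_neg_iff_add_eq_0)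

lemma scalar_sum: "\<kappa> (sum f S) = (\<Sum>x\<in>S. \<kappa> (f x))"
  by (induction S rule: infinite_finite_induct) (simp_all add: scalar_zero scalar_add)

lemma one_closed: "1 \<in> A"
  using scalar_closed[of 1] by (simp add: scalar_one)

lemma zero_closed: "0 \<in> A"
  using scalar_closed[of 0] by (simp add: scalar_zero)

lemma sum_closed: "(\<And>x. x \<in> S \<Longrightarrow> f x \<in> A) \<Longrightarrow> sum f S \<in> A"
  by (induction S rule: infinite_finite_induct) (simp_all add: zero_closed add_closed)

lemma power_closed: "x \<in> A \<Longrightarrow> x ^ n \<in> A"
  by (induction n) (simp_all add: one_closed mult_closed)

lemma prod_list_closed: "set xs \<subseteq> A \<Longrightarrow> prod_list xs \<in> A"
  by (induction xs) (simp_all add: one_closed mult_closed)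

lemma power_product_closed: "set ys \<subseteq> A \<Longrightarrow> power_product ys e \<in> A"
  unfolding power_product_def
  by (rule prod_list_closed) (auto dest!: set_zip_leftD intro!: power_closed)

context
  fixes Q assumes Q: "prime_in A Q"
begin

lemmas prime_simps = prime_inD[OF Q]

lemma prime_uminus: "x \<in> Q \<Longrightarrow> - x \<in> Q"
  using prime_simps(4)[OF scalar_closed[of "-1"], of x] by (simp add: scalar_uminus scalar_one)

lemma prime_diff: "x \<in> Q \<Longrightarrow> y \<in> Q \<Longrightarrow> x - y \<in> Q"
  using prime_simps(3)[OF _ prime_uminus, of x y] by simp

lemma prime_sum: "(\<And>x. x \<in> S \<Longrightarrow> f x \<in> Q) \<Longrightarrow> sum f S \<in> Q"
  by (induction S rule: infinite_finite_induct) (simp_all add: prime_simps(2,3))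

lemma prime_prod_list: "set xs \<subseteq> A - Q \<Longrightarrow> prod_list xs \<notin> Q"
proof (induction xs)
  case (Cons x xs)
  then show ?case using prime_simps(6)[of x "prod_list xs"] prod_list_closed[of xs] by auto
qed (simp add: prime_simps(5))

lemma prime_power: "x \<in> A - Q \<Longrightarrow> x ^ n \<notin> Q"
  using prime_prod_list[of "replicate n x"] by (auto simp: set_replicate_conv_if split: if_splits)

lemma scalar_notin_prime: "c \<noteq> 0 \<Longrightarrow> \<kappa> c \<notin> Q"
  using prime_simps(4)[OF scalar_closed[of "1 / c"], of "\<kappa> c"] prime_simps(5)
  by (auto simp: scalar_mult[symmetric] scalar_one)

end

text \<open>Dividing a relation by the lowest power of the first element, which lies outside \<open>Q 0\<close>, and
  reducing modulo \<open>Q 1\<close>, which contains this element, leaves a relation among the others.\<close>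

lemma prime_chain_independent:
  assumes "\<And>i. i \<le> length ys \<Longrightarrow> prime_in A (Q i)" "\<And>i. i < length ys \<Longrightarrow> Q i \<subseteq> Q (Suc i)"
    and "\<And>i. i < length ys \<Longrightarrow> ys ! i \<in> Q (Suc i) - Q i"
    and "finite E" "E \<noteq> {}" "\<And>e. e \<in> E \<Longrightarrow> length e = length ys" "\<And>e. e \<in> E \<Longrightarrow> f e \<noteq> 0"
  shows "(\<Sum>e\<in>E. \<kappa> (f e) * power_product ys e) \<notin> Q 0"
  using assms
proof (induction ys arbitrary: Q E f)
  case Nil
  then have "E = {[]}" by auto
  then show ?case using Nil scalar_notin_prime[of "Q 0" "f []"] by simp
next
  case (Cons y ys)
  have Q0: "prime_in A (Q 0)" and Q1: "prime_in A (Q (Suc 0))" using Cons.prems(1) by auto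
  have Q01: "Q 0 \<subseteq> Q (Suc 0)" using Cons.prems(2)[of 0] by simp
  have y: "y \<in> Q (Suc 0)" "y \<notin> Q 0" using Cons.prems(3)[of 0] by auto
  then have yA: "y \<in> A" using prime_inD(1)[OF Q1] by blast
  have ysA: "set ys \<subseteq> A"
  proof
    fix x assume "x \<in> set ys"
    then obtain i where "i < length ys" "x = ys ! i" by (metis in_set_conv_nth)
    then show "x \<in> A" using Cons.prems(3)[of "Suc i"] prime_inD(1)[OF Cons.prems(1)[of "Suc (Suc i)"]] by auto
  qed
  define a where "a = Min (hd ` E)"
  have a_le: "a \<le> hd e" if "e \<in> E" for e
    unfolding a_def using Cons.prems(4) that by (intro Min_le) auto
  have "a \<in> hd ` E" unfolding a_def using Cons.prems(4,5) by (intro Min_in) auto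
  have Ee: "e = hd e # tl e" "length (tl e) = length ys" if "e \<in> E" for e
    using Cons.prems(6)[OF that] by (cases e; simp)+
  define T where "T = (\<Sum>e\<in>E. \<kappa> (f e) * (y ^ (hd e - a) * power_product ys (tl e)))"
  have TA: "T \<in> A" unfolding T_def
    using ysA yA by (intro sum_closed mult_closed scalar_closed power_product_closed power_closed)
  show ?case
  proof
    assume "(\<Sum>e\<in>E. \<kappa> (f e) * power_product (y # ys) e) \<in> Q 0"
    also have "(\<Sum>e\<in>E. \<kappa> (f e) * power_product (y # ys) e) = y ^ a * T"
      unfolding T_def sum_distrib_left
    proof (rule sum.cong)
      fix e assume e: "e \<in> E"
      have "power_product (y # ys) e = y ^ hd e * power_product ys (tl e)"
        by (subst Ee(1)[OF e]) simp
      moreover have "y ^ hd e = y ^ a * y ^ (hd e - a)"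
        using a_le[OF e] by (simp flip: power_add)
      ultimately show "\<kappa> (f e) * power_product (y # ys) e = y ^ a * (\<kappa> (f e) * (y ^ (hd e - a) * power_product ys (tl e)))"
        by (simp add: ac_simps)
    qed simp
    finally have "T \<in> Q 0"
      using prime_inD(6)[OF Q0 power_closed[OF yA] TA] prime_power[OF Q0] y(2) yA by blast
    then have T1: "T \<in> Q (Suc 0)" using Q01 by blast
    define E1 where "E1 = {e \<in> E. hd e = a}"
    have "E1 \<subseteq> E" by (auto simp: E1_def)
    then have "T = (\<Sum>e\<in>E1. \<kappa> (f e) * (y ^ (hd e - a) * power_product ys (tl e)))
        + (\<Sum>e\<in>E - E1. \<kappa> (f e) * (y ^ (hd e - a) * power_product ys (tl e)))" (is "_ = ?T1 + ?T2")
      unfolding T_def by (subst sum.subset_diff[OF _ Cons.prems(4)]) (assumption, rule add.commute)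
    moreover have "?T2 \<in> Q (Suc 0)"
    proof (rule prime_sum[OF Q1])
      fix e assume "e \<in> E - E1"
      then have "hd e - a = Suc (hd e - a - 1)" using a_le[of e] by (auto simp: E1_def)
      then have "y ^ (hd e - a) = y ^ (hd e - a - 1) * y" by (metis power_Suc2)
      then have "\<kappa> (f e) * (y ^ (hd e - a) * power_product ys (tl e)) =
          (\<kappa> (f e) * (y ^ (hd e - a - 1) * power_product ys (tl e))) * y" by (simp add: ac_simps)
      also have "\<dots> \<in> Q (Suc 0)" using yA ysA y(1)
        by (intro prime_inD(4)[OF Q1] mult_closed scalar_closed power_product_closed power_closed)
      finally show "\<kappa> (f e) * (y ^ (hd e - a) * power_product ys (tl e)) \<in> Q (Suc 0)" .
    qed
    ultimately have "?T1 \<in> Q (Suc 0)" using T1 prime_diff[OF Q1, of T ?T2] by simp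
    \<comment> \<open>All exponent lists in \<open>E1\<close> start with \<open>a\<close>, so their
      tails stay distinct and the remaining power of \<open>y\<close> is 1.\<close>
    also have "?T1 = (\<Sum>e\<in>tl ` E1. \<kappa> (f (a # e)) * power_product ys e)"
    proof -
      have "inj_on tl E1"
        by (rule inj_onI) (metis (mono_tags, lifting) E1_def Ee(1) mem_Collect_eq)
      then show ?thesis
        unfolding sum.reindex[OF \<open>inj_on tl E1\<close>]
        using Ee(1) by (intro sum.cong) (auto simp: E1_def)
    qed
    finally have "(\<Sum>e\<in>tl ` E1. \<kappa> (f (a # e)) * power_product ys e) \<in> (\<lambda>i. Q (Suc i)) 0" .
    moreover have "(\<Sum>e\<in>tl ` E1. \<kappa> (f (a # e)) * power_product ys e) \<notin> (\<lambda>i. Q (Suc i)) 0"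
    proof (rule Cons.IH)
      show "tl ` E1 \<noteq> {}" using \<open>a \<in> hd ` E\<close> by (auto simp: E1_def)
      show "f (a # e) \<noteq> 0" if "e \<in> tl ` E1" for e
        using that Ee(1) Cons.prems(7) by (auto simp: E1_def)
      show "prime_in A (Q (Suc i))" if "i \<le> length ys" for i using Cons.prems(1)[of "Suc i"] that by simp
      show "Q (Suc i) \<subseteq> Q (Suc (Suc i))" if "i < length ys" for i using Cons.prems(2)[of "Suc i"] that by simp
      show "ys ! i \<in> Q (Suc (Suc i)) - Q (Suc i)" if "i < length ys" for i using Cons.prems(3)[of "Suc i"] that by simp
    qed (use Cons.prems(4) Ee in \<open>auto simp: E1_def\<close>)
    ultimately show False by blast
  qed
qed

end

section \<open>Spans of monomials modulo a prime, and their growth\<close>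

locale graded_span = subalgebra A \<kappa> for A :: "'r::comm_ring_1 set" and \<kappa> :: "'k::field \<Rightarrow> 'r" +
  fixes Q :: "'r set" and X :: "'m::comm_monoid_add \<Rightarrow> 'r"
  assumes prime: "prime_in A Q"
    and X_zero: "X 0 = 1" and X_add: "X (l + m) = X l * X m"
begin

text \<open>The span of the classes of the \<open>X l\<close> modulo \<open>Q\<close>, described by
  representatives instead of a quotient space.\<close>

definition spanned :: "'m set \<Rightarrow> 'r set" where
  "spanned L = {p. \<exists>f. p - (\<Sum>l\<in>L. \<kappa> (f l) * X l) \<in> Q}"

lemma spanned_of_prime: "p \<in> Q \<Longrightarrow> p \<in> spanned L"
  unfolding spanned_def by (intro CollectI exI[of _ "\<lambda>_. 0"]) (simp add: scalar_zero)

lemma spanned_add: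
  assumes "p \<in> spanned L" "q \<in> spanned L" shows "p + q \<in> spanned L"
proof -
  from assms obtain f g where "p - (\<Sum>l\<in>L. \<kappa> (f l) * X l) \<in> Q" "q - (\<Sum>l\<in>L. \<kappa> (g l) * X l) \<in> Q"
    by (auto simp: spanned_def)
  from prime_inD(3)[OF prime this] show ?thesis
    unfolding spanned_def
    by (intro CollectI exI[of _ "\<lambda>l. f l + g l"]) (simp add: scalar_add sum.distrib algebra_simps)
qed

lemma spanned_sum: "(\<And>x. x \<in> S \<Longrightarrow> p x \<in> spanned L) \<Longrightarrow> sum p S \<in> spanned L"
  by (induction S rule: infinite_finite_induct)
    (simp_all add: spanned_add spanned_of_prime prime_inD(2)[OF prime])

lemma spanned_basis:
  assumes "finite L" "l \<in> L" shows "\<kappa> c * X l \<in> spanned L"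
proof -
  have "(\<Sum>m\<in>L. \<kappa> (if m = l then c else 0) * X m) = (\<Sum>m\<in>L. if m = l then \<kappa> c * X m else 0)"
    by (intro sum.cong) (auto simp: scalar_zero)
  also have "\<dots> = \<kappa> c * X l" using assms by simp
  finally show ?thesis
    unfolding spanned_def using prime_inD(2)[OF prime]
    by (intro CollectI exI[of _ "\<lambda>m. if m = l then c else 0"]) simp
qed

lemma spanned_decomp:
  assumes "p \<in> spanned L"
  obtains f a where "p = (\<Sum>l\<in>L. \<kappa> (f l) * X l) + a" "a \<in> Q"
proof -
  from assms obtain f where "p - (\<Sum>l\<in>L. \<kappa> (f l) * X l) \<in> Q" by (auto simp: spanned_def)
  then show thesis by (intro that[of f "p - (\<Sum>l\<in>L. \<kappa> (f l) * X l)"]) simp_all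
qed

lemma spanned_mono:
  assumes "p \<in> spanned L" "L \<subseteq> L'" "finite L'" shows "p \<in> spanned L'"
proof -
  obtain f a where "p = (\<Sum>l\<in>L. \<kappa> (f l) * X l) + a" "a \<in> Q" by (rule spanned_decomp[OF assms(1)])
  moreover have "(\<Sum>l\<in>L. \<kappa> (f l) * X l) + a \<in> spanned L'"
    using assms(2,3) \<open>a \<in> Q\<close> by (intro spanned_add spanned_sum spanned_of_prime spanned_basis) auto
  ultimately show ?thesis by simp
qed

text \<open>With \<open>p = P + a\<close> and \<open>q = P' + a'\<close>, where \<open>a\<close> and
  \<open>a'\<close> lie in \<open>Q\<close>, the product is \<open>P P' + (P a' + q a)\<close>. The
  bracket lies in \<open>Q\<close> because \<open>P\<close> and \<open>q\<close> lie in
  \<open>A\<close>.\<close>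

lemma spanned_mult:
  assumes p: "p \<in> spanned L" and q: "q \<in> spanned L'" "q \<in> A" and XA: "X ` L \<subseteq> A"
    and fin: "finite L''" and sub: "\<And>l l'. l \<in> L \<Longrightarrow> l' \<in> L' \<Longrightarrow> l + l' \<in> L''"
  shows "p * q \<in> spanned L''"
proof -
  obtain f a where f: "p = (\<Sum>l\<in>L. \<kappa> (f l) * X l) + a" "a \<in> Q" by (rule spanned_decomp[OF p])
  obtain g a' where g: "q = (\<Sum>l\<in>L'. \<kappa> (g l) * X l) + a'" "a' \<in> Q" by (rule spanned_decomp[OF q(1)])
  define P where "P = (\<Sum>l\<in>L. \<kappa> (f l) * X l)"
  have PA: "P \<in> A" unfolding P_def using XA by (intro sum_closed mult_closed scalar_closed) auto
  have "P * (\<Sum>l\<in>L'. \<kappa> (g l) * X l) = (\<Sum>l\<in>L. \<Sum>l'\<in>L'. \<kappa> (f l * g l') * X (l + l'))"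
    unfolding P_def sum_product by (intro sum.cong) (simp_all add: scalar_mult X_add ac_simps)
  also have "\<dots> \<in> spanned L''" by (intro spanned_sum spanned_basis fin sub)
  finally have 1: "P * (\<Sum>l\<in>L'. \<kappa> (g l) * X l) \<in> spanned L''" .
  have "P * a' + q * a \<in> Q"
    using g(2) f(2) PA q(2) by (intro prime_inD(3)[OF prime] prime_inD(4)[OF prime])
  then have 2: "P * a' + q * a \<in> spanned L''" by (rule spanned_of_prime)
  have "p * q = P * (\<Sum>l\<in>L'. \<kappa> (g l) * X l) + (P * a' + q * a)"
    unfolding f(1) P_def[symmetric] by (simp add: g(1) algebra_simps)
  then show ?thesis using spanned_add[OF 1 2] by simp
qed

text \<open>Coordinates modulo \<open>Q\<close> give \<open>card L\<close> homogeneous equations in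
  \<open>card E\<close> unknowns; a non-trivial solution is the relation.\<close>

lemma spanned_relation:
  assumes "finite L" "finite E" "card L < card E" "\<And>e. e \<in> E \<Longrightarrow> p e \<in> spanned L"
  obtains x where "\<exists>e\<in>E. x e \<noteq> 0" "(\<Sum>e\<in>E. \<kappa> (x e) * p e) \<in> Q"
proof -
  have "\<forall>e. \<exists>f. e \<in> E \<longrightarrow> p e - (\<Sum>l\<in>L. \<kappa> (f l) * X l) \<in> Q"
    using assms(4) by (auto simp: spanned_def)
  then obtain f where f: "\<And>e. e \<in> E \<Longrightarrow> p e - (\<Sum>l\<in>L. \<kappa> (f e l) * X l) \<in> Q" by metis
  obtain x where x: "\<exists>e\<in>E. x e \<noteq> 0" "\<And>l. l \<in> L \<Longrightarrow> (\<Sum>e\<in>E. x e * f e l) = 0"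
    using homogeneous_system_solution[OF assms(1-3)] by blast
  have "(\<Sum>e\<in>E. \<kappa> (x e) * (p e - (\<Sum>l\<in>L. \<kappa> (f e l) * X l))) \<in> Q"
    by (intro prime_sum[OF prime] prime_inD(4)[OF prime] scalar_closed f)
  also have "(\<Sum>e\<in>E. \<kappa> (x e) * (p e - (\<Sum>l\<in>L. \<kappa> (f e l) * X l))) =
      (\<Sum>e\<in>E. \<kappa> (x e) * p e) - (\<Sum>e\<in>E. \<Sum>l\<in>L. \<kappa> (x e * f e l) * X l)"
    by (simp add: right_diff_distrib sum_subtractf sum_distrib_left scalar_mult mult.assoc)
  also have "(\<Sum>e\<in>E. \<Sum>l\<in>L. \<kappa> (x e * f e l) * X l) = (\<Sum>l\<in>L. \<kappa> (\<Sum>e\<in>E. x e * f e l) * X l)"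
    by (subst sum.swap) (simp add: scalar_sum sum_distrib_right)
  also have "\<dots> = 0" using x(2) by (simp add: scalar_zero)
  finally show thesis using that x(1) by simp
qed

text \<open>Degrees add up along the filtration \<open>F\<close>: a power \<open>y ^ a\<close> with
  \<open>a \<le> N\<close> has degree at most \<open>N * d\<close>, and there are
  \<open>length ys\<close> such factors.\<close>

lemma power_product_spanned:
  fixes F :: "nat \<Rightarrow> 'm set"
  assumes fin: "\<And>N. finite (F N)" and zero: "0 \<in> F 0" and mono: "\<And>N M. N \<le> M \<Longrightarrow> F N \<subseteq> F M"
    and add: "\<And>N M l l'. l \<in> F N \<Longrightarrow> l' \<in> F M \<Longrightarrow> l + l' \<in> F (N + M)"
    and XA: "\<And>N. X ` F N \<subseteq> A"
    and ys: "set ys \<subseteq> A \<inter> spanned (F d)"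
    and e: "length e = length ys" "set e \<subseteq> {..N}"
  shows "power_product ys e \<in> spanned (F (length ys * N * d))"
proof -
  have one: "1 \<in> spanned (F 0)"
    using spanned_basis[OF fin zero, of 1] by (simp add: scalar_one X_zero)
  have pow: "y ^ a \<in> spanned (F (a * d))" if "y \<in> A \<inter> spanned (F d)" for y a
  proof (induction a)
    case (Suc a)
    have "y * y ^ a \<in> spanned (F (Suc a * d))"
      using that Suc by (intro spanned_mult[of _ "F d" _ "F (a * d)"] power_closed XA fin) (auto intro: add)
    then show ?case by simp
  qed (simp add: one)
  show ?thesis using ys e
  proof (induction ys arbitrary: e)
    case (Cons y ys)
    then obtain a e' where e: "e = a # e'" "length e' = length ys" "set e' \<subseteq> {..N}" "a \<le> N"
      by (cases e) auto
    have "y ^ a * power_product ys e' \<in> spanned (F (a * d + length ys * N * d))"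
      using Cons e by (intro spanned_mult[OF pow Cons.IH] power_product_closed XA fin add) auto
    then have "y ^ a * power_product ys e' \<in> spanned (F (length (y # ys) * N * d))"
      by (rule spanned_mono) (use e(4) in \<open>auto intro!: mono fin simp: distrib_right\<close>)
    then show ?case by (simp add: e)
  qed (simp add: one)
qed

text \<open>There are \<open>N ^ r\<close> power products of \<open>r\<close> elements with
  exponents below \<open>N\<close>, and they lie in a span of at most polynomial size of degree
  \<open>q\<close> in \<open>N\<close>. For \<open>r > q\<close> and large \<open>N\<close> this
  forces a relation, against the independence of elements picked from the steps of a prime
  chain.\<close>

lemma chain_length_le_growth:
  fixes F :: "nat \<Rightarrow> 'm set" and P :: "nat \<Rightarrow> 'r set"
  assumes fin: "\<And>N. finite (F N)" and zero: "0 \<in> F 0" and mono: "\<And>N M. N \<le> M \<Longrightarrow> F N \<subseteq> F M"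
    and add: "\<And>N M l l'. l \<in> F N \<Longrightarrow> l' \<in> F M \<Longrightarrow> l + l' \<in> F (N + M)"
    and XA: "\<And>N. X ` F N \<subseteq> A"
    and growth: "\<And>N. card (F N) \<le> (C * N + 1) ^ q"
    and ys: "set ys \<subseteq> A \<inter> spanned (F d)"
    and chain: "P 0 = Q" "\<And>i. i \<le> length ys \<Longrightarrow> prime_in A (P i)"
      "\<And>i. i < length ys \<Longrightarrow> P i \<subseteq> P (Suc i)" "\<And>i. i < length ys \<Longrightarrow> ys ! i \<in> P (Suc i) - P i"
  shows "length ys \<le> q"
proof (rule ccontr)
  assume "\<not> length ys \<le> q"
  then have q: "q + 1 \<le> length ys" by simp
  define r where "r = length ys"
  \<comment> \<open>\<open>D\<close> absorbs the constants, so that \<open>F (r * N * d)\<close> has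
    at most \<open>(D * N) ^ q\<close> elements; \<open>N = D ^ q + 1\<close> then makes this
    smaller than \<open>N ^ (q + 1)\<close>.\<close>
  define D where "D = C * (r * d) + 1"
  define N where "N = D ^ q + 1"
  define E where "E = {e. set e \<subseteq> {..<N} \<and> length e = r}"
  have finE: "finite E" unfolding E_def by (rule finite_lists_length_eq) simp
  have "card (F (r * N * d)) \<le> (C * (r * N * d) + 1) ^ q" by (rule growth)
  also have "\<dots> \<le> (D * N) ^ q"
    by (intro power_mono) (simp_all add: D_def N_def algebra_simps)
  also have "\<dots> = D ^ q * N ^ q" by (rule power_mult_distrib)
  also have "\<dots> < N * N ^ q" by (intro mult_strict_right_mono) (simp_all add: N_def)
  also have "\<dots> = N ^ (q + 1)" by simp
  also have "\<dots> \<le> N ^ r" using q by (intro power_increasing) (simp_all add: N_def r_def)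
  also have "\<dots> = card E" unfolding E_def by (simp add: card_lists_length_eq)
  finally have card: "card (F (r * N * d)) < card E" .
  have "power_product ys e \<in> spanned (F (r * N * d))" if "e \<in> E" for e
    unfolding r_def using that
    by (intro power_product_spanned fin zero mono add XA ys) (auto simp: E_def r_def)
  then obtain x where x: "\<exists>e\<in>E. x e \<noteq> 0" "(\<Sum>e\<in>E. \<kappa> (x e) * power_product ys e) \<in> Q"
    using spanned_relation[OF fin finE card, of "power_product ys"] by blast
  \<comment> \<open>Independence is stated for non-zero coefficients, so the zero terms are dropped
    first.\<close>
  define E' where "E' = {e \<in> E. x e \<noteq> 0}"
  have "finite E'" using finE by (simp add: E'_def)
  then have "(\<Sum>e\<in>E'. \<kappa> (x e) * power_product ys e) \<notin> P 0"
    using x(1) chain by (intro prime_chain_independent) (auto simp: E'_def E_def r_def)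
  moreover have "(\<Sum>e\<in>E'. \<kappa> (x e) * power_product ys e) = (\<Sum>e\<in>E. \<kappa> (x e) * power_product ys e)"
    using finE by (intro sum.mono_neutral_left) (auto simp: E'_def scalar_zero)
  ultimately show False using x(2) chain(1) by simp
qed

end

section \<open>The fiber ring and the Rees algebra\<close>

text \<open>A pure tensor \<open>a \<otimes> \<psi> r\<close> equals
  \<open>\<phi> r a \<otimes> 1\<close>, so with \<psi> surjective the map
  \<open>a \<mapsto> a \<otimes> 1\<close> reaches every generator. It sends \<open>\<phi> r\<close>
  to \<open>1 \<otimes> \<psi> r\<close>, which vanishes when \<open>\<psi> r\<close> does.\<close>

lemma tensor_product_surjection:
  assumes "cring R" "cring A" "cring B" "\<phi> \<in> ring_hom R A" "\<psi> \<in> ring_hom R B"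
    and surj: "\<psi> ` carrier R = carrier B"
  obtains \<theta> where "ring_hom_ring A (tensor_product R A \<phi> B \<psi>) \<theta>"
    "\<theta> ` carrier A = carrier (tensor_product R A \<phi> B \<psi>)"
    "\<And>r. r \<in> carrier R \<Longrightarrow> \<psi> r = \<zero>\<^bsub>B\<^esub> \<Longrightarrow> \<theta> (\<phi> r) = \<zero>\<^bsub>tensor_product R A \<phi> B \<psi>\<^esub>"
proof -
  interpret R: cring R by fact
  interpret A: cring A by fact
  interpret B: cring B by fact
  define P where "P = pair_ring A B"
  interpret P: cring P unfolding P_def using assms by (intro cring_pair_ring)
  define K where "K = Idl\<^bsub>P\<^esub> (tensor_relations R A \<phi> B \<psi>)"
  have T: "tensor_product R A \<phi> B \<psi> = P Quot K" by (simp add: tensor_product_def P_def K_def)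
  interpret T: cring "P Quot K" using cring_tensor_product[OF assms(1-5)] by (simp add: T)
  have carr: "f \<in> carrier P \<longleftrightarrow> Poly_Mapping.keys f \<subseteq> carrier A \<times> carrier B" for f
    by (simp add: P_def pair_ring_def)
  have addP: "f \<oplus>\<^bsub>P\<^esub> g = f + g" and multP: "f \<otimes>\<^bsub>P\<^esub> g = pair_mult A B f g"
    and zeroP: "\<zero>\<^bsub>P\<^esub> = 0" and oneP: "\<one>\<^bsub>P\<^esub> = frag_of (\<one>\<^bsub>A\<^esub>, \<one>\<^bsub>B\<^esub>)" for f g
    by (simp_all add: P_def pair_ring_def)
  \<comment> \<open>The tensor relations use the subtraction of the type class, the ideal lemmas
    that of the ring record; the two agree on the carrier.\<close>
  have minusP: "f \<ominus>\<^bsub>P\<^esub> g = f - g" if "f \<in> carrier P" "g \<in> carrier P" for f g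
  proof -
    have "- g \<in> carrier P" using that by (simp add: carr)
    then have "\<ominus>\<^bsub>P\<^esub> g = - g" using that by (intro P.minus_equality) (simp_all add: addP zeroP)
    then show ?thesis by (simp add: a_minus_def addP)
  qed
  have diff_closed: "f - g \<in> carrier P" if "f \<in> carrier P" "g \<in> carrier P" for f g
    using P.minus_closed[OF that] minusP[OF that] by simp
  have frag: "frag_of (a, b) \<in> carrier P" if "a \<in> carrier A" "b \<in> carrier B" for a b
    using that by (simp add: carr)
  have rel: "tensor_relations R A \<phi> B \<psi> \<subseteq> carrier P"
    unfolding tensor_relations_def
    using assms(4,5) by (auto intro!: diff_closed frag simp: ring_hom_closed)
  have idK: "ideal K P" unfolding K_def by (intro P.genideal_ideal rel)
  have relK: "tensor_relations R A \<phi> B \<psi> \<subseteq> K" unfolding K_def by (intro P.genideal_self rel)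
  define \<pi> where "\<pi> = (\<lambda>f. K +>\<^bsub>P\<^esub> f)"
  have \<pi>hom: "\<pi> \<in> ring_hom P (P Quot K)" unfolding \<pi>_def by (rule ideal.rcos_ring_hom[OF idK])
  interpret \<pi>: ring_hom_cring P "P Quot K" \<pi>
    by (intro ring_hom_cring.intro ring_hom_cring_axioms.intro P.cring_axioms T.cring_axioms \<pi>hom)
  have \<pi>_eq: "\<pi> f = \<pi> g" if "f - g \<in> K" "f \<in> carrier P" "g \<in> carrier P" for f g
    using P.quotient_eq_iff_same_a_r_cos[OF idK that(2,3)] that(1) minusP[OF that(2,3)]
    by (simp add: \<pi>_def)
  define \<theta> where "\<theta> = (\<lambda>a. \<pi> (frag_of (a, \<one>\<^bsub>B\<^esub>)))"
  have \<theta>hom: "\<theta> \<in> ring_hom A (P Quot K)"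
  proof (rule ring_hom_memI)
    fix a assume a: "a \<in> carrier A"
    then show "\<theta> a \<in> carrier (P Quot K)" by (simp add: \<theta>_def frag)
    fix a' assume a': "a' \<in> carrier A"
    have "frag_of (a \<otimes>\<^bsub>A\<^esub> a', \<one>\<^bsub>B\<^esub>) = frag_of (a, \<one>\<^bsub>B\<^esub>) \<otimes>\<^bsub>P\<^esub> frag_of (a', \<one>\<^bsub>B\<^esub>)"
      by (simp add: multP pair_mult_of)
    then show "\<theta> (a \<otimes>\<^bsub>A\<^esub> a') = \<theta> a \<otimes>\<^bsub>P Quot K\<^esub> \<theta> a'"
      using a a' by (simp add: \<theta>_def frag)
    have "frag_of (a \<oplus>\<^bsub>A\<^esub> a', \<one>\<^bsub>B\<^esub>) - frag_of (a, \<one>\<^bsub>B\<^esub>) - frag_of (a', \<one>\<^bsub>B\<^esub>)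
        \<in> tensor_relations R A \<phi> B \<psi>"
      unfolding tensor_relations_def using a a' by blast
    then have "frag_of (a \<oplus>\<^bsub>A\<^esub> a', \<one>\<^bsub>B\<^esub>) - (frag_of (a, \<one>\<^bsub>B\<^esub>) \<oplus>\<^bsub>P\<^esub> frag_of (a', \<one>\<^bsub>B\<^esub>)) \<in> K"
      using relK by (auto simp: addP algebra_simps)
    from \<pi>_eq[OF this] show "\<theta> (a \<oplus>\<^bsub>A\<^esub> a') = \<theta> a \<oplus>\<^bsub>P Quot K\<^esub> \<theta> a'"
      using a a' by (simp add: \<theta>_def frag)
  next
    show "\<theta> \<one>\<^bsub>A\<^esub> = \<one>\<^bsub>P Quot K\<^esub>" using \<pi>.hom_one by (simp add: \<theta>_def oneP)
  qed
  interpret \<theta>: ring_hom_cring A "P Quot K" \<theta>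
    by (intro ring_hom_cring.intro ring_hom_cring_axioms.intro A.cring_axioms T.cring_axioms \<theta>hom)
  have move: "\<pi> (frag_of (a, \<psi> r)) = \<theta> (\<phi> r \<otimes>\<^bsub>A\<^esub> a)" if a: "a \<in> carrier A" and r: "r \<in> carrier R" for a r
  proof -
    have rc: "\<phi> r \<in> carrier A" "\<psi> r \<in> carrier B" using r assms(4,5) by (simp_all add: ring_hom_closed)
    have "frag_of (\<phi> r \<otimes>\<^bsub>A\<^esub> a, \<one>\<^bsub>B\<^esub>) - frag_of (a, \<psi> r \<otimes>\<^bsub>B\<^esub> \<one>\<^bsub>B\<^esub>) \<in> tensor_relations R A \<phi> B \<psi>"
      unfolding tensor_relations_def using a r by blast
    then have "frag_of (\<phi> r \<otimes>\<^bsub>A\<^esub> a, \<one>\<^bsub>B\<^esub>) - frag_of (a, \<psi> r) \<in> K" using relK rc by auto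
    from \<pi>_eq[OF this] show ?thesis using a rc by (simp add: \<theta>_def frag)
  qed
  have range: "f \<in> carrier P \<and> (\<exists>a\<in>carrier A. \<pi> f = \<theta> a)"
    if "Poly_Mapping.keys f \<subseteq> carrier A \<times> carrier B" for f
    using that
  proof (induction f rule: frag_induction)
    case zero
    show ?case using \<theta>.hom_zero \<pi>.hom_zero by (intro conjI bexI[of _ "\<zero>\<^bsub>A\<^esub>"]) (auto simp: zeroP carr)
  next
    case (one x)
    then obtain a b where x: "x = (a, b)" "a \<in> carrier A" "b \<in> carrier B" by auto
    then obtain r where "r \<in> carrier R" "b = \<psi> r" using surj by auto
    then have "\<pi> (frag_of x) = \<theta> (\<phi> r \<otimes>\<^bsub>A\<^esub> a)" "\<phi> r \<otimes>\<^bsub>A\<^esub> a \<in> carrier A"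
      using move[of a r] x ring_hom_closed[OF assms(4)] by simp_all
    then show ?case using x frag by blast
  next
    case (diff f g)
    then obtain a a' where a: "a \<in> carrier A" "a' \<in> carrier A" "\<pi> f = \<theta> a" "\<pi> g = \<theta> a'"
      and fg: "f \<in> carrier P" "g \<in> carrier P" by blast
    have "\<pi> (f \<ominus>\<^bsub>P\<^esub> g) = \<theta> (a \<ominus>\<^bsub>A\<^esub> a')" using a fg by (simp add: a_minus_def)
    then have "\<pi> (f - g) = \<theta> (a \<ominus>\<^bsub>A\<^esub> a')" unfolding minusP[OF fg] .
    then show ?case using diff_closed[OF fg] A.minus_closed[OF a(1,2)] by blast
  qed
  show thesis
  proof (rule that[of \<theta>])
    show "ring_hom_ring A (tensor_product R A \<phi> B \<psi>) \<theta>"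
      unfolding T by (intro ring_hom_ringI2 A.ring_axioms T.ring_axioms \<theta>hom)
    show "\<theta> ` carrier A = carrier (tensor_product R A \<phi> B \<psi>)"
    proof
      show "\<theta> ` carrier A \<subseteq> carrier (tensor_product R A \<phi> B \<psi>)" unfolding T by auto
      show "carrier (tensor_product R A \<phi> B \<psi>) \<subseteq> \<theta> ` carrier A"
      proof
        fix z assume "z \<in> carrier (tensor_product R A \<phi> B \<psi>)"
        then obtain f where "f \<in> carrier P" "z = \<pi> f"
          unfolding T by (auto simp: FactRing_def A_RCOSETS_def' \<pi>_def)
        then show "z \<in> \<theta> ` carrier A" using range[of f] by (auto simp: carr)
      qed
    qed
    fix r assume r: "r \<in> carrier R" "\<psi> r = \<zero>\<^bsub>B\<^esub>"
    \<comment> \<open>Additivity in the second argument at \<open>0 + 0\<close> leaves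
      \<open>- (1 \<otimes> 0)\<close> as a relation, so \<open>1 \<otimes> 0\<close> vanishes in
      the quotient.\<close>
    have z: "frag_of (\<one>\<^bsub>A\<^esub>, \<zero>\<^bsub>B\<^esub>) \<in> K"
    proof -
      have "frag_of (\<one>\<^bsub>A\<^esub>, \<zero>\<^bsub>B\<^esub> \<oplus>\<^bsub>B\<^esub> \<zero>\<^bsub>B\<^esub>) - frag_of (\<one>\<^bsub>A\<^esub>, \<zero>\<^bsub>B\<^esub>) - frag_of (\<one>\<^bsub>A\<^esub>, \<zero>\<^bsub>B\<^esub>) \<in> tensor_relations R A \<phi> B \<psi>"
        unfolding tensor_relations_def using A.one_closed B.zero_closed by blast
      then have n: "- frag_of (\<one>\<^bsub>A\<^esub>, \<zero>\<^bsub>B\<^esub>) \<in> K" using relK by auto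
      have "\<zero>\<^bsub>P\<^esub> \<ominus>\<^bsub>P\<^esub> (- frag_of (\<one>\<^bsub>A\<^esub>, \<zero>\<^bsub>B\<^esub>)) \<in> K"
        unfolding a_minus_def using ideal.axioms(1)[OF idK] n
        by (intro additive_subgroup.a_closed additive_subgroup.zero_closed additive_subgroup.a_inv_closed)
      then show ?thesis using minusP[of "\<zero>\<^bsub>P\<^esub>" "- frag_of (\<one>\<^bsub>A\<^esub>, \<zero>\<^bsub>B\<^esub>)"] ideal.Icarr[OF idK n]
        by (simp add: zeroP carr)
    qed
    have "\<theta> (\<phi> r) = \<pi> (frag_of (\<one>\<^bsub>A\<^esub>, \<zero>\<^bsub>B\<^esub>))"
      using move[OF A.one_closed r(1)] ring_hom_closed[OF assms(4) r(1)] r(2) by simp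
    also have "\<dots> = \<pi> \<zero>\<^bsub>P\<^esub>" using z by (intro \<pi>_eq) (simp_all add: zeroP frag carr)
    finally show "\<theta> (\<phi> r) = \<zero>\<^bsub>tensor_product R A \<phi> B \<psi>\<^esub>" by (simp add: T)
  qed
qed

lemma primeideal_imp_prime_in:
  assumes "primeideal Q (cring_class_ops\<lparr>carrier := A\<rparr>)"
  shows "prime_in A Q"
proof -
  interpret primeideal Q "cring_class_ops\<lparr>carrier := A\<rparr>" by fact
  show ?thesis
    unfolding prime_in_def
  proof (intro conjI ballI impI)
    show "1 \<notin> Q" using one_imp_carrier I_notcarr by (auto simp: cring_class_ops_def)
    show "Q \<subseteq> A" "0 \<in> Q"
      using a_subset additive_subgroup.zero_closed[OF is_additive_subgroup] by (simp_all add: cring_class_ops_def)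
  next
    fix x y assume "x \<in> Q" "y \<in> Q"
    then show "x + y \<in> Q"
      using additive_subgroup.a_closed[OF is_additive_subgroup, of x y] by (simp add: cring_class_ops_def)
  next
    fix a x assume "a \<in> A" "x \<in> Q"
    then show "a * x \<in> Q" using I_l_closed[of x a] by (simp add: cring_class_ops_def)
  next
    fix x y assume "x \<in> A" "y \<in> A" "x * y \<in> Q"
    then show "x \<in> Q \<or> y \<in> Q" using I_prime[of x y] by (simp add: cring_class_ops_def)
  qed
qed

lemma ideal_irrelevant_ideal: "ideal irrelevant_ideal (poly_ring :: ('n, 'k::field) mpoly ring)"
  unfolding irrelevant_ideal_def by (intro genideal_ideal_class) (auto simp: carrier_class)

text \<open>Primes pull back along the surjection from the Rees algebra. Surjectivity keeps the
  inclusions strict, and every preimage contains the irrelevant ideal because the surjection kills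
  it.\<close>

lemma fiber_ring_prime_chain:
  fixes I :: "('n, 'k::field) mpoly set"
  assumes I: "ideal I poly_ring"
    and P: "\<And>i. i \<le> m \<Longrightarrow> primeideal (P i) (fiber_ring I)" "\<And>i. i < m \<Longrightarrow> P i \<subset> P (Suc i)"
  obtains Q where "\<And>i. i \<le> m \<Longrightarrow> prime_in (carrier (rees_algebra I)) (Q i)"
    "\<And>i. i < m \<Longrightarrow> Q i \<subset> Q (Suc i)" "\<And>i r. i \<le> m \<Longrightarrow> r \<in> irrelevant_ideal \<Longrightarrow> [:r:] \<in> Q i"
proof -
  let ?J = "irrelevant_ideal :: ('n, 'k) mpoly set"
  let ?A = "rees_algebra I"
  let ?\<psi> = "\<lambda>r. ?J +>\<^bsub>poly_ring\<^esub> r"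
  interpret J: ideal ?J "poly_ring :: ('n, 'k) mpoly ring" by (rule ideal_irrelevant_ideal)
  have cB: "cring (poly_ring Quot ?J)" by (intro J.quotient_is_cring cring_class)
  have \<psi>: "?\<psi> \<in> ring_hom poly_ring (poly_ring Quot ?J)" by (rule J.rcos_ring_hom)
  have "?\<psi> ` carrier poly_ring = carrier (poly_ring Quot ?J)"
    unfolding FactRing_def A_RCOSETS_def' by (simp add: UNION_singleton_eq_range)
  note surjection = tensor_product_surjection[OF cring_class cring_rees(1)[OF I] cB cring_rees(2)[OF I] \<psi> this,
      folded fiber_ring_def]
  obtain \<theta> where \<theta>: "ring_hom_ring ?A (fiber_ring I) \<theta>" "\<theta> ` carrier ?A = carrier (fiber_ring I)"
    "\<And>r. r \<in> carrier poly_ring \<Longrightarrow> ?\<psi> r = \<zero>\<^bsub>poly_ring Quot ?J\<^esub> \<Longrightarrow> \<theta> [:r:] = \<zero>\<^bsub>fiber_ring I\<^esub>"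
    by (rule surjection) blast
  define Q where "Q = (\<lambda>i. {a \<in> carrier ?A. \<theta> a \<in> P i})"
  show thesis
  proof (rule that[of Q])
    fix i assume i: "i \<le> m"
    have "primeideal (Q i) ?A"
      unfolding Q_def by (intro ring_hom_ring.primeideal_vimage[OF \<theta>(1)] cring_rees(1)[OF I] P(1) i)
    then show "prime_in (carrier ?A) (Q i)"
      by (intro primeideal_imp_prime_in) (simp add: rees_algebra_def)
    fix r :: "('n, 'k) mpoly" assume r: "r \<in> ?J"
    have "r \<ominus>\<^bsub>poly_ring\<^esub> \<zero>\<^bsub>poly_ring\<^esub> \<in> ?J" unfolding minus_class zero_class using r by simp
    then have "?\<psi> r = ?\<psi> \<zero>\<^bsub>poly_ring\<^esub>"
      by (rule ring.quotient_eq_iff_same_a_r_cos[OF cring.axioms(1)[OF cring_class] ideal_irrelevant_ideal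
            carrier_class carrier_class, THEN iffD1])
    also have "\<dots> = \<zero>\<^bsub>poly_ring Quot ?J\<^esub>"
      by (rule ring_hom_zero[OF \<psi> cring.axioms(1)[OF cring_class] cring.axioms(1)[OF cB]])
    finally have "\<theta> [:r:] = \<zero>\<^bsub>fiber_ring I\<^esub>" by (rule \<theta>(3)[OF carrier_class])
    moreover have "\<zero>\<^bsub>fiber_ring I\<^esub> \<in> P i"
      using additive_subgroup.zero_closed[OF ideal.axioms(1)[OF primeideal.axioms(1)[OF P(1)[OF i]]]] .
    moreover have "[:r:] \<in> carrier ?A"
      using ring_hom_closed[OF cring_rees(2)[OF I], of r] by (simp add: carrier_class)
    ultimately show "[:r:] \<in> Q i" by (simp add: Q_def)
  next
    fix i assume i: "i < m"
    then obtain z where z: "z \<in> P (Suc i)" "z \<notin> P i" using P(2) by blast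
    moreover have "z \<in> carrier (fiber_ring I)"
      using ideal.Icarr[OF primeideal.axioms(1)[OF P(1)[of "Suc i"]] z(1)] i by simp
    then obtain a where "a \<in> carrier ?A" "z = \<theta> a" using \<theta>(2) by blast
    ultimately have "a \<in> Q (Suc i) - Q i" by (simp add: Q_def)
    moreover have "Q i \<subseteq> Q (Suc i)" using P(2)[OF i] by (auto simp: Q_def)
    ultimately show "Q i \<subset> Q (Suc i)" by blast
  qed
qed

section \<open>Monomials and generators of the Rees algebra\<close>

definition scalar :: "'k \<Rightarrow> ('n, 'k::field) mpoly poly" where
  "scalar c = [:Poly_Mapping.single 0 c:]"

text \<open>The pair \<open>(b, j)\<close> stands for \<open>x^b t^j\<close>; pairs add as these
  monomials multiply, as \<open>graded_span\<close> requires of its \<open>X\<close>.\<close>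

definition rees_monomial :: "('n \<Rightarrow>\<^sub>0 nat) \<times> nat \<Rightarrow> ('n, 'k::field) mpoly poly" where
  "rees_monomial l = Polynomial.monom (monomial (fst l)) (snd l)"

lemma rees_monomial_zero: "rees_monomial 0 = 1"
  by (simp add: rees_monomial_def monomial_def monom_0 flip: one_pCons)

lemma rees_monomial_add: "rees_monomial (l + m) = rees_monomial l * rees_monomial m"
  by (simp add: rees_monomial_def mult_monom monomial_mult)

lemma rees_monomial_list:
  "(rees_monomial (sum_list us, length us) :: ('n, 'k::field) mpoly poly) = (\<Prod>b\<leftarrow>us. rees_monomial (b, 1))"
proof (induction us)
  case (Cons b us)
  have "(rees_monomial (sum_list (b # us), length (b # us)) :: ('n, 'k) mpoly poly) =
      rees_monomial (b, 1) * rees_monomial (sum_list us, length us)"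
    unfolding rees_monomial_add[symmetric] by simp
  then show ?case using Cons by simp
qed (simp add: rees_monomial_zero[unfolded zero_prod_def])

lemma subalgebra_rees:
  fixes I :: "('n, 'k::field) mpoly set"
  assumes I: "ideal I poly_ring"
  shows "subalgebra (carrier (rees_algebra I)) (scalar :: 'k \<Rightarrow> ('n, 'k) mpoly poly)"
proof -
  interpret R: cring "rees_algebra I" by (rule cring_rees(1)[OF I])
  show ?thesis
  proof
    fix x y assume "x \<in> carrier (rees_algebra I)" "y \<in> carrier (rees_algebra I)"
    then show "x + y \<in> carrier (rees_algebra I)" "x * y \<in> carrier (rees_algebra I)"
      using R.a_closed[of x y] R.m_closed[of x y] by (simp_all add: rees_algebra_def cring_class_ops_def)
  next
    fix c :: 'k
    show "scalar c \<in> carrier (rees_algebra I)"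
      using ring_hom_closed[OF cring_rees(2)[OF I]] by (simp add: scalar_def carrier_class)
  qed (simp_all add: scalar_def single_add Poly_Mapping.mult_single mult.commute flip: one_pCons)
qed

lemma subset_Idl: "G \<subseteq> Idl\<^bsub>poly_ring\<^esub> G"
  by (rule genideal_self_class) (simp add: carrier_class subset_iff)

lemma single_in_irrelevant_ideal:
  assumes "u \<noteq> 0"
  shows "Poly_Mapping.single u c \<in> (irrelevant_ideal :: ('n, 'k::field) mpoly set)"
proof -
  obtain i where i: "Poly_Mapping.lookup u i \<noteq> 0" using assms by (metis lookup_zero poly_mapping_eqI)
  define v where "v = u - Poly_Mapping.single i 1"
  have u: "u = Poly_Mapping.single i 1 + v"
    using i by (intro poly_mapping_eqI) (auto simp add: v_def lookup_add lookup_minus lookup_single when_def)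
  have "monomial (Poly_Mapping.single i 1) \<in> (irrelevant_ideal :: ('n, 'k) mpoly set)"
    unfolding irrelevant_ideal_def by (rule subsetD[OF subset_Idl rangeI])
  from ideal.I_l_closed[OF ideal_irrelevant_ideal this, of "Poly_Mapping.single v c"]
  show ?thesis by (simp add: class_simps monomial_def Poly_Mapping.mult_single u add.commute)
qed

text \<open>Every term other than the constant one lies in the irrelevant ideal, and the induction
  adds one term at a time. Hence modulo a prime containing that ideal each polynomial becomes a
  scalar.\<close>

lemma diff_constant_in_irrelevant_ideal:
  "r - Poly_Mapping.single 0 (Poly_Mapping.lookup r 0) \<in> (irrelevant_ideal :: ('n, 'k::field) mpoly set)"
proof (induction r rule: update_induct)
  case const
  then show ?case using ideal_classD(1)[OF ideal_irrelevant_ideal] by simp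
next
  case (update r u c)
  have "Poly_Mapping.update u c r = r + Poly_Mapping.single u c"
    using update by (intro poly_mapping_eqI) (auto simp: lookup_update lookup_add lookup_single in_keys_iff when_def)
  moreover have "Poly_Mapping.single u c - Poly_Mapping.single 0 (Poly_Mapping.lookup (Poly_Mapping.single u c) 0) \<in> (irrelevant_ideal :: ('n, 'k) mpoly set)"
    using ideal_classD(1)[OF ideal_irrelevant_ideal] single_in_irrelevant_ideal[of u c]
    by (cases "u = 0") (simp_all add: lookup_single)
  moreover have "r + Poly_Mapping.single u c - Poly_Mapping.single 0 (Poly_Mapping.lookup (r + Poly_Mapping.single u c) 0) =
      (r - Poly_Mapping.single 0 (Poly_Mapping.lookup r 0)) +
      (Poly_Mapping.single u c - Poly_Mapping.single 0 (Poly_Mapping.lookup (Poly_Mapping.single u c) 0))"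
    by (simp add: lookup_add single_add)
  ultimately show ?case
    using ideal_classD(2)[OF ideal_irrelevant_ideal update.IH] by metis
qed

lemma rees_monomial_generator_closed:
  fixes I :: "('n, 'k::field) mpoly set"
  assumes I: "ideal I poly_ring" and b: "monomial b \<in> I"
  shows "rees_monomial (b, 1) \<in> carrier (rees_algebra I)"
proof -
  interpret M: Group.comm_monoid "ideals_set (poly_ring :: ('n, 'k) mpoly ring)"
    by (rule cring.ideals_set_is_comm_monoid[OF cring_class])
  have "I [^]\<^bsub>ideals_set poly_ring\<^esub> (1::nat) = I"
    using M.nat_pow_eone[of I] I by (simp add: ideals_set_def)
  then show ?thesis
    using b ideal_classD(1)[OF ideals_power(1)[OF I]]
    by (auto simp: rees_algebra_def rees_monomial_def simp del: nat_pow_Suc One_nat_def)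
qed

text \<open>The Rees algebra is generated by the constants and the elements \<open>x^b t\<close>.
  The polynomials \<open>r\<close> with \<open>r t\<close> in \<open>V\<close> form an ideal that
  contains the generators, hence \<open>I\<close>; products then yield the powers of
  \<open>I\<close> in the higher degrees.\<close>

lemma rees_algebra_minimal:
  fixes I :: "('n, 'k::field) mpoly set"
  assumes I: "Idl\<^bsub>poly_ring\<^esub> (monomial ` B) = I"
    and add: "\<And>x y. x \<in> V \<Longrightarrow> y \<in> V \<Longrightarrow> x + y \<in> V" and mult: "\<And>x y. x \<in> V \<Longrightarrow> y \<in> V \<Longrightarrow> x * y \<in> V"
    and const: "\<And>r. [:r:] \<in> V" and gen: "\<And>b. b \<in> B \<Longrightarrow> rees_monomial (b, 1) \<in> V"
  shows "carrier (rees_algebra I) \<subseteq> V"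
proof -
  have zero: "0 \<in> V" using const[of 0] by simp
  define J where "J = {r. Polynomial.monom r 1 \<in> V}"
  have J: "ideal J poly_ring"
  proof (rule idealI)
    show "subgroup J (add_monoid poly_ring)"
    proof (rule group.subgroupI[OF abelian_group.a_group[OF cring_class.abelian_group_axioms]])
      have "0 \<in> J" using zero by (simp add: J_def)
      then show "J \<noteq> {}" by blast
    next
      fix p assume "p \<in> J"
      \<comment> \<open>Negatives come from multiplication by the constant
        \<open>-1\<close>.\<close>
      then have "[:-1:] * Polynomial.monom p 1 \<in> V" by (intro mult const) (simp add: J_def)
      then have "- p \<in> J" by (simp add: J_def smult_monom)
      then show "inv\<^bsub>add_monoid poly_ring\<^esub> p \<in> J"
        by (fold a_inv_def) (simp add: uminus_class)
    next
      fix p q assume "p \<in> J" "q \<in> J"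
      then show "p \<otimes>\<^bsub>add_monoid poly_ring\<^esub> q \<in> J"
        using add by (auto simp: J_def cring_class_ops_def simp flip: add_monom)
    qed (simp add: cring_class_ops_def)
    fix p q assume "p \<in> J"
    then have "[:q:] * Polynomial.monom p 1 \<in> V" by (intro mult const) (simp add: J_def)
    then have "q * p \<in> J" by (simp add: J_def smult_monom)
    then show "q \<otimes>\<^bsub>poly_ring\<^esub> p \<in> J" "p \<otimes>\<^bsub>poly_ring\<^esub> q \<in> J"
      by (simp_all add: times_class mult.commute)
  qed (simp add: cring_class.ring_axioms)
  have "I \<subseteq> J"
    unfolding I[symmetric] using gen
    by (intro genideal_minimal_class J) (auto simp: J_def rees_monomial_def)
  have pow: "Polynomial.monom p m \<in> V" if "p \<in> I [^]\<^bsub>ideals_set poly_ring\<^esub> m" for p and m :: nat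
    using that
  proof (induction m arbitrary: p)
    case 0
    then show ?case using const by (simp add: monom_0)
  next
    case (Suc m)
    then have "p \<in> ideal_prod poly_ring (I [^]\<^bsub>ideals_set poly_ring\<^esub> m) I"
      by (simp add: ideals_set_def)
    then show ?case
    proof (induction rule: ideal_prod.induct)
      case (prod i j)
      then have "Polynomial.monom i m * Polynomial.monom j 1 \<in> V"
        using Suc.IH \<open>I \<subseteq> J\<close> by (intro mult) (auto simp: J_def)
      then show ?case by (simp add: mult_monom times_class)
    next
      case (sum s1 s2)
      then show ?case using add by (auto simp: plus_class simp flip: add_monom)
    qed
  qed
  show ?thesis
  proof
    fix p assume "p \<in> carrier (rees_algebra I)"
    then have "Polynomial.monom (Polynomial.coeff p m) m \<in> V" for m
      by (intro pow) (simp add: rees_algebra_def)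
    then have "(\<Sum>m\<in>M. Polynomial.monom (Polynomial.coeff p m) m) \<in> V" for M
      by (induction M rule: infinite_finite_induct) (simp_all add: zero add)
    from this[of "{..degree p}"] show "p \<in> V" by (simp add: poly_as_sum_of_monoms)
  qed
qed

lemma list_sums_properties:
  shows "0 \<in> list_sums T 0"
    and "T \<subseteq> T' \<Longrightarrow> N \<le> M \<Longrightarrow> list_sums T N \<subseteq> list_sums T' M"
    and "l \<in> list_sums T N \<Longrightarrow> l' \<in> list_sums T M \<Longrightarrow> l + l' \<in> list_sums T (N + M)"
proof -
  show "0 \<in> list_sums T 0"
    unfolding list_sums_def by (rule image_eqI[of _ _ "[]"]) (simp_all add: zero_prod_def)
  show "T \<subseteq> T' \<Longrightarrow> N \<le> M \<Longrightarrow> list_sums T N \<subseteq> list_sums T' M"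
    unfolding list_sums_def by (rule image_mono) auto
  assume "l \<in> list_sums T N" "l' \<in> list_sums T M"
  then obtain us vs where "set us \<subseteq> T" "length us \<le> N" "l = (sum_list us, length us)"
    "set vs \<subseteq> T" "length vs \<le> M" "l' = (sum_list vs, length vs)"
    by (auto simp: list_sums_def)
  then show "l + l' \<in> list_sums T (N + M)"
    unfolding list_sums_def by (intro image_eqI[of _ _ "us @ vs"]) auto
qed

text \<open>Modulo \<open>Q 0\<close> constants reduce to scalars, so the Rees algebra is spanned by
  the products of generators outside \<open>Q 0\<close>. Finitely many of these generators serve for
  a given chain; \<open>active_normals\<close> applies to them and provides \<open>U\<close>, and
  the growth estimate bounds \<open>m\<close> by \<open>CARD('n) - card U + 1\<close>.\<close>

lemma chain_length_bound:
  fixes I :: "('n::finite, 'k::field) mpoly set" and w h :: "nat \<Rightarrow> real ^ 'n"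
  assumes IB: "Idl\<^bsub>poly_ring\<^esub> (monomial ` B) = I"
    and desc: "halfspace_description (convex hull (point ` B)) s w b t h c"
    and ex: "\<exists>\<alpha> \<beta>. negative_combination s w t h \<alpha> \<beta>"
    and k: "k = (LEAST m. \<exists>\<alpha> \<beta>. negative_combination s w t h \<alpha> \<beta> \<and> m = card {j. j < t \<and> \<beta> j \<noteq> 0})"
    and Q: "\<And>i. i \<le> m \<Longrightarrow> prime_in (carrier (rees_algebra I)) (Q i)" "\<And>i. i < m \<Longrightarrow> Q i \<subset> Q (Suc i)"
    and irr: "\<And>r. r \<in> irrelevant_ideal \<Longrightarrow> [:r:] \<in> Q 0"
  shows "m + (s + k) \<le> CARD('n) + 1"
proof -
  define A where "A = carrier (rees_algebra I)"
  have I: "ideal I poly_ring"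
    unfolding IB[symmetric] by (rule genideal_ideal_class) (auto simp: carrier_class)
  have BI: "monomial g \<in> I" if "g \<in> B" for g
    unfolding IB[symmetric] using that by (intro subsetD[OF subset_Idl] imageI)
  interpret G: graded_span A scalar "Q 0" rees_monomial
    unfolding graded_span_def graded_span_axioms_def A_def
    using Q(1)[of 0] by (simp add: subalgebra_rees[OF I] rees_monomial_zero rees_monomial_add)
  have gen_closed: "rees_monomial (g, 1) \<in> A" if "g \<in> B" for g
    unfolding A_def using I BI[OF that] by (rule rees_monomial_generator_closed)
  have list_closed: "rees_monomial (sum_list us, length us) \<in> A" if "set us \<subseteq> B" for us
    unfolding rees_monomial_list using that gen_closed by (intro G.prod_list_closed) auto
  define S where "S = {g \<in> B. rees_monomial (g, 1) \<notin> Q 0}"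
  \<comment> \<open>Each element of \<open>V\<close> carries its own finite set \<open>T\<close> and
    length bound \<open>N\<close>; \<open>common\<close> enlarges them so that two elements share
    them.\<close>
  define V where "V = {p \<in> A. \<exists>T N. finite T \<and> T \<subseteq> S \<and> p \<in> G.spanned (list_sums T N)}"
  have XA: "rees_monomial ` list_sums T N \<subseteq> A" if "T \<subseteq> B" for T N
    using that list_closed by (auto simp: list_sums_def)
  have up: "p \<in> G.spanned (list_sums T' M)"
    if "p \<in> G.spanned (list_sums T N)" "T \<subseteq> T'" "N \<le> M" "finite T'" for p T T' N M
    using that by (intro G.spanned_mono[OF that(1)] list_sums_properties(2) finite_list_sums)
  have common: "\<exists>T N. finite T \<and> T \<subseteq> S \<and> x \<in> G.spanned (list_sums T N) \<and> y \<in> G.spanned (list_sums T N)"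
    if "x \<in> V" "y \<in> V" for x y
  proof -
    from that obtain T N T' N' where "finite T" "T \<subseteq> S" "x \<in> G.spanned (list_sums T N)"
      "finite T'" "T' \<subseteq> S" "y \<in> G.spanned (list_sums T' N')" by (auto simp: V_def)
    then show ?thesis
      by (intro exI[of _ "T \<union> T'"] exI[of _ "N + N'"]) (auto intro: up)
  qed
  have "A \<subseteq> V"
    unfolding A_def
  proof (rule rees_algebra_minimal[OF IB])
    fix x y assume xy: "x \<in> V" "y \<in> V"
    then have xyA: "x \<in> A" "y \<in> A" by (auto simp: V_def)
    from common[OF xy] obtain T N where T: "finite T" "T \<subseteq> S"
      and xT: "x \<in> G.spanned (list_sums T N)" "y \<in> G.spanned (list_sums T N)" by blast
    show "x + y \<in> V"
      using T xyA G.spanned_add[OF xT] G.add_closed by (auto simp: V_def)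
    have "T \<subseteq> B" using T by (auto simp: S_def)
    have "x * y \<in> G.spanned (list_sums T (N + N))"
      by (rule G.spanned_mult[OF xT xyA(2) XA[OF \<open>T \<subseteq> B\<close>] finite_list_sums[OF T(1)]]) (rule list_sums_properties(3))
    then show "x * y \<in> V" using T xyA G.mult_closed by (auto simp: V_def)
  next
    fix r :: "('n, 'k) mpoly"
    have "r - Poly_Mapping.single 0 (Poly_Mapping.lookup r 0) \<in> irrelevant_ideal"
      by (rule diff_constant_in_irrelevant_ideal)
    from irr[OF this] have "[:r:] - scalar (Poly_Mapping.lookup r 0) \<in> Q 0" by (simp add: scalar_def)
    then have "[:r:] - (\<Sum>l\<in>list_sums {} 0. scalar (Poly_Mapping.lookup r 0) * rees_monomial l) \<in> Q 0"
      by (simp add: list_sums_def rees_monomial_zero[unfolded zero_prod_def])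
    then have "[:r:] \<in> G.spanned (list_sums {} 0)"
      unfolding G.spanned_def by (intro CollectI exI[of _ "\<lambda>_. Poly_Mapping.lookup r 0"])
    moreover have "[:r:] \<in> A"
      unfolding A_def using ring_hom_closed[OF cring_rees(2)[OF I], of r] by (simp add: carrier_class)
    ultimately show "[:r:] \<in> V" unfolding V_def by blast
  next
    fix g assume g: "g \<in> B"
    show "rees_monomial (g, 1) \<in> V"
    proof (cases "g \<in> S")
      case True
      have "(g, 1) \<in> list_sums {g} 1"
        unfolding list_sums_def by (rule image_eqI[of _ _ "[g]"]) auto
      from G.spanned_basis[OF finite_list_sums this, of 1]
      have "rees_monomial (g, 1) \<in> G.spanned (list_sums {g} 1)" by (simp add: G.scalar_one)
      then show ?thesis unfolding V_def using True gen_closed[OF g] by blast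
    next
      \<comment> \<open>A generator inside \<open>Q 0\<close> is 0 modulo \<open>Q 0\<close>, so it
        lies in every span.\<close>
      case False
      then have "rees_monomial (g, 1) \<in> G.spanned (list_sums {} 0)"
        using g by (intro G.spanned_of_prime) (simp add: S_def)
      then show ?thesis unfolding V_def using gen_closed[OF g] by blast
    qed
  qed
  have "\<exists>y. y \<in> Q (Suc i) - Q i" if "i < m" for i using Q(2)[OF that] by blast
  \<comment> \<open>One element from each step of the chain; these are the elements that are
    independent modulo \<open>Q 0\<close>.\<close>
  then obtain y where y: "\<And>i. i < m \<Longrightarrow> y i \<in> Q (Suc i) - Q i" by metis
  define ys where "ys = map y [0..<m]"
  have ysA: "set ys \<subseteq> A"
  proof
    fix x assume "x \<in> set ys"
    then obtain i where "i < m" "x = y i" by (auto simp: ys_def)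
    then show "x \<in> A" using y[of i] prime_inD(1)[OF Q(1)[of "Suc i"]] by (auto simp: A_def)
  qed
  have "\<exists>T N. finite T \<and> T \<subseteq> S \<and> set zs \<subseteq> G.spanned (list_sums T N)" if "set zs \<subseteq> A" for zs
    using that
  proof (induction zs)
    case Nil
    show ?case by (intro exI[of _ "{}"]) auto
  next
    case (Cons z zs)
    then obtain T N where T: "finite T" "T \<subseteq> S" "set zs \<subseteq> G.spanned (list_sums T N)" by auto
    from Cons.prems \<open>A \<subseteq> V\<close> obtain T' N' where "finite T'" "T' \<subseteq> S" "z \<in> G.spanned (list_sums T' N')"
      by (auto simp: V_def)
    with T show ?case
      by (intro exI[of _ "T \<union> T'"] exI[of _ "N + N'"]) (auto intro: up)
  qed
  from this[OF ysA] obtain T N where T: "finite T" "T \<subseteq> S" "set ys \<subseteq> G.spanned (list_sums T N)" by blast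
  obtain us where us: "set us = T" using finite_list[OF T(1)] by blast
  have TB: "T \<subseteq> B" using T(2) by (auto simp: S_def)
  have usB: "set us \<subseteq> B" using us TB by simp
  \<comment> \<open>A non-zero \<open>y\<close> would write a product of elements outside the prime
    \<open>Q 0\<close> as a multiple of \<open>x^y\<close>, which lies in
    \<open>Q 0\<close>.\<close>
  have undominated: "y = 0"
    if gs: "set gs \<subseteq> B" "length gs = N * length us" and eq: "sum_list gs + y = sum_list (concat (replicate N us))"
    for N gs y
  proof -
    define vs where "vs = concat (replicate N us)"
    have len: "length gs = length vs" using gs(2) by (simp add: vs_def length_concat sum_list_replicate)
    have "set vs \<subseteq> S" using us T(2) by (auto simp: vs_def)
    then have "rees_monomial (sum_list vs, length vs) \<notin> Q 0"
      unfolding rees_monomial_list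
      using gen_closed by (intro G.prime_prod_list[OF G.prime]) (auto simp: S_def)
    moreover have "rees_monomial (sum_list vs, length vs) \<in> Q 0" if "y \<noteq> 0"
    proof -
      have "(rees_monomial (sum_list vs, length vs) :: ('n, 'k) mpoly poly) =
          rees_monomial (sum_list gs, length gs) * rees_monomial (y, 0)"
        using eq len by (simp flip: rees_monomial_add add: vs_def)
      moreover have "rees_monomial (y, 0) \<in> Q 0"
        using irr[OF single_in_irrelevant_ideal[OF that, of 1]]
        by (simp add: rees_monomial_def monom_0 monomial_def)
      ultimately show ?thesis
        using prime_inD(4)[OF G.prime list_closed[OF gs(1)]] by simp
    qed
    ultimately show ?thesis by blast
  qed
  obtain U :: "(real ^ 'n) set" where U: "independent U" "s + k \<le> card U"
    "\<And>v. v \<in> U \<Longrightarrow> \<exists>d. \<forall>b\<in>set us. v \<bullet> point b = d"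
    by (rule active_normals[OF desc ex k usB undominated]) blast+
  have const: "\<exists>d. \<forall>b\<in>T. v \<bullet> point b = d" if "v \<in> U" for v using U(3)[OF that] us by simp
  obtain C where C: "\<And>N. card (list_sums T N) \<le> (C * N + 1) ^ (CARD('n) - card U + 1)"
    using card_list_sums[OF T(1) U(1) const] by blast
  have "length ys \<le> CARD('n) - card U + 1"
  proof (rule G.chain_length_le_growth[where F = "list_sums T" and P = Q and d = N])
    show "prime_in A (Q i)" if "i \<le> length ys" for i using that Q(1) by (simp add: A_def ys_def)
    show "Q i \<subseteq> Q (Suc i)" if "i < length ys" for i using that Q(2)[of i] by (auto simp: ys_def)
    show "ys ! i \<in> Q (Suc i) - Q i" if "i < length ys" for i using that y[of i] by (auto simp: ys_def)
    show "card (list_sums T N) \<le> (C * N + 1) ^ (CARD('n) - card U + 1)" for N by (rule C)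
    show "set ys \<subseteq> A \<inter> G.spanned (list_sums T N)" using T(3) ysA by blast
    show "l + l' \<in> list_sums T (N + M)" if "l \<in> list_sums T N" "l' \<in> list_sums T M" for N M l l'
      using that by (rule list_sums_properties(3))
  qed (use T(1) in \<open>simp_all add: finite_list_sums list_sums_properties(1,2) XA[OF TB]\<close>)
  \<comment> \<open>This makes the truncated subtraction \<open>CARD('n) - card U\<close>
    exact.\<close>
  moreover have "card U \<le> CARD('n)"
    using independent_card_le[OF U(1)] by simp
  ultimately show ?thesis using U(2) by (simp add: ys_def)
qed

theorem theorem1:
  fixes I :: "('n::finite, 'k::field) mpoly set"
    and w h :: "nat \<Rightarrow> real ^ 'n"
    and b c :: "nat \<Rightarrow> real"
    and s t k :: nat
  assumes "infinite (UNIV :: 'k set)"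
    and "monomial_ideal I"
    and "halfspace_description (newton_polytope I) s w b t h c"
    and "\<exists>\<alpha> \<beta>. negative_combination s w t h \<alpha> \<beta>"
    and "k = (LEAST m. \<exists>\<alpha> \<beta>. negative_combination s w t h \<alpha> \<beta> \<and> m = card {j. j < t \<and> \<beta> j \<noteq> 0})"
  shows "analytic_spread I + enat (s + k) \<le> enat (CARD('n) + 1)"
proof -
  define B where "B = {b. monomial b \<in> min_monomial_generators I}"
  have "monomial_generators I (min_monomial_generators I)"
    unfolding min_monomial_generators_def
    by (rule theI'[OF ex1_min_monomial_generators[OF assms(2)], THEN conjunct1])
  then have gens: "min_monomial_generators I \<subseteq> range monomial" "Idl\<^bsub>poly_ring\<^esub> (min_monomial_generators I) = I"
    unfolding monomial_generators_def by blast+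
  have "min_monomial_generators I = monomial ` B" using gens(1) unfolding B_def by blast
  with gens(2) have IB: "Idl\<^bsub>poly_ring\<^esub> (monomial ` B) = I" by simp
  have I: "ideal I poly_ring"
    unfolding IB[symmetric] by (rule genideal_ideal_class) (auto simp: carrier_class)
  have "newton_polytope I = convex hull (point ` B)"
    unfolding newton_polytope_def B_def point_def image_Collect ..
  then have desc: "halfspace_description (convex hull (point ` B)) s w b t h c" using assms(3) by simp
  have bound: "m + (s + k) \<le> CARD('n) + 1"
    if P: "\<forall>i\<le>m. primeideal (P i) (fiber_ring I)" "\<forall>i<m. P i \<subset> P (Suc i)" for P and m :: nat
  proof -
    obtain Q where Q: "\<And>i. i \<le> m \<Longrightarrow> prime_in (carrier (rees_algebra I)) (Q i)"
      "\<And>i. i < m \<Longrightarrow> Q i \<subset> Q (Suc i)" "\<And>i r. i \<le> m \<Longrightarrow> r \<in> irrelevant_ideal \<Longrightarrow> [:r:] \<in> Q i"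
      using fiber_ring_prime_chain[OF I, of m P] P by blast
    show ?thesis
      by (rule chain_length_bound[where Q = Q, OF IB desc assms(4,5) Q(1,2)]) (use Q(3)[of 0] in auto)
  qed
  \<comment> \<open>The empty list of generators gives this bound without reference to any prime
    chain; it makes the truncated subtraction below exact.\<close>
  have sk: "s + k \<le> CARD('n) + 1"
  proof -
    obtain U :: "(real ^ 'n) set" where "independent U" "s + k \<le> card U"
      by (rule active_normals[OF desc assms(4,5), of "[]"]) auto
    then show ?thesis using independent_card_le[of U] by simp
  qed
  \<comment> \<open>With \<open>s + k\<close> moved to the right the bound is a constant, so the
    supremum can be tested chain by chain.\<close>
  have "analytic_spread I \<le> enat (CARD('n) + 1 - (s + k))"
    unfolding analytic_spread_def krull_dim_def
  proof (rule Sup_least)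
    fix x assume "x \<in> {enat m |m. \<exists>P. (\<forall>i\<le>m. primeideal (P i) (fiber_ring I)) \<and> (\<forall>i<m. P i \<subset> P (Suc i))}"
    then obtain m P where "x = enat m" "\<forall>i\<le>m. primeideal (P i) (fiber_ring I)" "\<forall>i<m. P i \<subset> P (Suc i)" by blast
    then show "x \<le> enat (CARD('n) + 1 - (s + k))" using bound[of m P] by simp
  qed
  then have "analytic_spread I + enat (s + k) \<le> enat (CARD('n) + 1 - (s + k)) + enat (s + k)"
    by (rule add_right_mono)
  then show ?thesis using sk by simp
qed

end
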